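(* Let $G$ be the complement of the Higman–Sims graph (so $|V(G)|=100$ and $\alpha(G)=2$). Then $G$ has a model of $K_{50}$ in which every branch set has exactly two vertices; in particular $G$ has a model of $K_{\lceil |V(G)|/2\rceil}$ with every branch set of size at most two.
   Context: Let $S(3,6,22)$ be the Steiner system of $77$ $6$-subsets (blocks) of $\{1,\dots,22\}$ such that every $3$-subset lies in exactly one block. The Higman–Sims graph has vertex set consisting of the $77$ blocks, the $22$ points $1,\dots,22$, and one further vertex $\infty$; two blocks are adjacent iff disjoint, a point is adjacent to a block iff it belongs to the block, $\infty$ is adjacent to all $22$ points, and there are no other edges. It is strongly regular with parameters $(100,22,0,6)$. A model of $K_t$ in $G$ is a collection of $t$ pairwise disjoint vertex sets (branch sets), each inducing a connected subgraph, with an edge of $G$ between every two of them. *)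

theory Defs
  imports Complex_Main "Graph_Theory.Graph_Theory"
begin

(* A simple graph is a loop-free symmetric pair digraph: every edge is represented by
   both of its orientations. *)

definition steiner_system :: "nat \<Rightarrow> nat \<Rightarrow> 'a set \<Rightarrow> 'a set set \<Rightarrow> bool" where
  "steiner_system t k V \<B> \<longleftrightarrow>
     finite V \<and>
     (\<forall>B\<in>\<B>. B \<subseteq> V \<and> card B = k) \<and>
     (\<forall>T. T \<subseteq> V \<and> card T = t \<longrightarrow> (\<exists>!B. B \<in> \<B> \<and> T \<subseteq> B))"

datatype hs_vertex = Block "nat set" | Point nat | Infinity

fun hs_adj :: "hs_vertex \<Rightarrow> hs_vertex \<Rightarrow> bool" where
  "hs_adj (Block B) (Block C) \<longleftrightarrow> B \<inter> C = {}"
| "hs_adj (Point p) (Block B) \<longleftrightarrow> p \<in> B"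
| "hs_adj (Block B) (Point p) \<longleftrightarrow> p \<in> B"
| "hs_adj Infinity (Point p) \<longleftrightarrow> True"
| "hs_adj (Point p) Infinity \<longleftrightarrow> True"
| "hs_adj _ _ \<longleftrightarrow> False"

definition higman_sims :: "nat set set \<Rightarrow> hs_vertex pair_pre_digraph" where
  "higman_sims \<B> =
     (let V = Block ` \<B> \<union> Point ` {1..22} \<union> {Infinity}
      in \<lparr> pverts = V, parcs = {(u, v). u \<in> V \<and> v \<in> V \<and> hs_adj u v} \<rparr>)"

definition graph_complement :: "'a pair_pre_digraph \<Rightarrow> 'a pair_pre_digraph" where
  "graph_complement G =
     \<lparr> pverts = pverts G,
       parcs = {(u, v). u \<in> pverts G \<and> v \<in> pverts G \<and> u \<noteq> v \<and> (u, v) \<notin> parcs G} \<rparr>"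

definition independent_set :: "'a pair_pre_digraph \<Rightarrow> 'a set \<Rightarrow> bool" where
  "independent_set G S \<longleftrightarrow> S \<subseteq> pverts G \<and> (\<forall>u\<in>S. \<forall>v\<in>S. (u, v) \<notin> parcs G)"

definition independence_number :: "'a pair_pre_digraph \<Rightarrow> nat" where
  "independence_number G = Max (card ` {S. independent_set G S})"

(* Branch sets are nonempty because the library's notion of connected excludes the null
   graph, so the members of a disjoint family are automatically distinct and
   the model can be given as a set of branch sets. *)
definition complete_model :: "'a pair_pre_digraph \<Rightarrow> nat \<Rightarrow> 'a set set \<Rightarrow> bool" where
  "complete_model G t \<M> \<longleftrightarrow>
     finite \<M> \<and> card \<M> = t \<and>
     (\<forall>X\<in>\<M>. X \<subseteq> pverts G \<and> connected (with_proj G \<restriction> X)) \<and>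
     (\<forall>X\<in>\<M>. \<forall>Y\<in>\<M>. X \<noteq> Y \<longrightarrow>
        X \<inter> Y = {} \<and> (\<exists>x\<in>X. \<exists>y\<in>Y. (x, y) \<in> parcs G))"

lemma pair_graph_higman_sims:
  assumes "steiner_system 3 6 {1..22} \<B>"
  shows "pair_graph (higman_sims \<B>)"
proof -
  have sub: "\<And>B. B \<in> \<B> \<Longrightarrow> B \<subseteq> {1..22} \<and> B \<noteq> {}"
    using assms unfolding steiner_system_def by force
  then have "finite \<B>"
    by (meson PowI finite_Pow_iff finite_atLeastAtMost finite_subset subsetI)
  define V where "V = Block ` \<B> \<union> Point ` {1..22} \<union> {Infinity}"
  have finV: "finite V" using \<open>finite \<B>\<close> by (simp add: V_def)
  have eq: "higman_sims \<B> = \<lparr> pverts = V, parcs = {(u, v). u \<in> V \<and> v \<in> V \<and> hs_adj u v} \<rparr>"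
    by (simp add: higman_sims_def V_def)
  have adj_sym: "hs_adj u v \<Longrightarrow> hs_adj v u" for u v
    by (cases u; cases v) auto
  have irrefl: "v \<in> V \<Longrightarrow> \<not> hs_adj v v" for v
    using sub by (cases v) (auto simp: V_def)
  have fin: "finite {(u, v). u \<in> V \<and> v \<in> V \<and> hs_adj u v}"
    by (rule finite_subset[of _ "V \<times> V"]) (use finV in auto)
  show ?thesis
    unfolding eq
    by unfold_locales
      (use finV fin adj_sym irrefl in \<open>auto simp: symmetric_def intro!: symI\<close>)
qed

lemma pair_graph_complement:
  assumes "pair_graph G"
  shows "pair_graph (graph_complement G)"
proof -
  interpret pair_graph G by fact
  have fin: "finite {(u, v). u \<in> pverts G \<and> v \<in> pverts G \<and> u \<noteq> v \<and> (u, v) \<notin> parcs G}"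
    by (rule finite_subset[of _ "pverts G \<times> pverts G"]) (use pair_finite_verts in auto)
  have adj_sym: "(u, v) \<in> parcs G \<Longrightarrow> (v, u) \<in> parcs G" for u v
    using pair_sym_arcs by (auto simp: symmetric_def dest: symD)
  show ?thesis
    unfolding graph_complement_def
    by unfold_locales
      (use pair_finite_verts fin adj_sym in \<open>auto simp: symmetric_def intro!: symI\<close>)
qed

end

theory Submission
  imports Defs
begin

text \<open>
  Only the strongly regular parameters (100,22,0,6) of the Higman--Sims graph matter. What is
  needed is a perfect pairing of its vertices into nonadjacent pairs such that no two pairs span
  an induced 4-cycle. In such a graph any three pairwise nonadjacent vertices have exactly two
  common neighbours. Fix an edge \<open>ab\<close>; the neighbourhoods of \<open>a\<close> and \<open>b\<close> are disjoint cocliques,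
  and 56 vertices \<open>W\<close> remain. Pair \<open>a\<close> with some \<open>l \<in> N b\<close> and \<open>b\<close> with some \<open>x \<in> N a\<close>, and pair
  the rest of \<open>N a\<close>, of \<open>N b\<close> and of \<open>W\<close> internally; two pairs inside one coclique, or one pair
  inside each, never conflict. All three internal pairings come from switching arguments: if
  \<open>{u, v}\<close> is a bad pair, replace it and some pair \<open>{e, f}\<close> by \<open>{u, e}\<close> and \<open>{v, f}\<close>, counting the
  choices of \<open>e\<close> that could do harm. For the cocliques one ensures that no vertex of \<open>W\<close> sees three
  pairs; then at most 6 + 6 partners of a vertex of \<open>W\<close> conflict with pairs of the cocliques, which
  together with 10 neighbours and at most 5 conflicts inside \<open>W\<close> leaves an admissible switch.
\<close>

section \<open>Pairings and switching\<close>

text \<open>A perfect matching is encoded as a fixed-point-free involution. Values outside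
  \<open>S\<close> are unconstrained, so pairings of disjoint sets can be glued into one
  function.\<close>

definition pairing :: "'a set \<Rightarrow> ('a \<Rightarrow> 'a) \<Rightarrow> bool" where
  "pairing S \<pi> \<longleftrightarrow> (\<forall>x\<in>S. \<pi> x \<in> S \<and> \<pi> x \<noteq> x \<and> \<pi> (\<pi> x) = x)"

text \<open>All four new values are read off the old \<open>\<pi>\<close>. The four points are
  distinct only when \<open>e\<close> lies outside the pair of \<open>u\<close>, as the lemmas on
  switching assume.\<close>

definition switch :: "('a \<Rightarrow> 'a) \<Rightarrow> 'a \<Rightarrow> 'a \<Rightarrow> 'a \<Rightarrow> 'a" where
  "switch \<pi> u e = \<pi>(u := e, e := u, \<pi> u := \<pi> e, \<pi> e := \<pi> u)"

lemma pairingD: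
  assumes "pairing S \<pi>" "x \<in> S"
  shows "\<pi> x \<in> S" "\<pi> x \<noteq> x" "\<pi> (\<pi> x) = x"
  using assms by (auto simp: pairing_def)

lemma pairing_inj_on: "pairing S \<pi> \<Longrightarrow> inj_on \<pi> S"
  by (metis inj_onI pairingD(3))

lemma switch_simps:
  assumes "pairing S \<pi>" "u \<in> S" "e \<in> S" "e \<noteq> u" "e \<noteq> \<pi> u"
  shows "switch \<pi> u e u = e" "switch \<pi> u e e = u"
    "switch \<pi> u e (\<pi> u) = \<pi> e" "switch \<pi> u e (\<pi> e) = \<pi> u"
    "x \<notin> {u, e, \<pi> u, \<pi> e} \<Longrightarrow> switch \<pi> u e x = \<pi> x"
proof -
  have "\<pi> e \<noteq> \<pi> u" "\<pi> e \<noteq> u" "\<pi> u \<noteq> u" "\<pi> e \<noteq> e"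
    using assms by (metis pairingD)+
  then show "switch \<pi> u e u = e" "switch \<pi> u e e = u"
    "switch \<pi> u e (\<pi> u) = \<pi> e" "switch \<pi> u e (\<pi> e) = \<pi> u"
    "x \<notin> {u, e, \<pi> u, \<pi> e} \<Longrightarrow> switch \<pi> u e x = \<pi> x"
    using assms(4,5) by (auto simp: switch_def)
qed

lemma pairing_switch:
  assumes "pairing S \<pi>" "u \<in> S" "e \<in> S" "e \<noteq> u" "e \<noteq> \<pi> u"
  shows "pairing S (switch \<pi> u e)"
  unfolding pairing_def
proof
  fix x assume x: "x \<in> S"
  note sw = switch_simps[OF assms]
  have mem: "\<pi> u \<in> S" "\<pi> e \<in> S" "\<pi> (\<pi> u) = u" "\<pi> (\<pi> e) = e" "\<pi> e \<noteq> \<pi> u"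
    using assms by (metis pairingD)+
  show "switch \<pi> u e x \<in> S \<and> switch \<pi> u e x \<noteq> x \<and> switch \<pi> u e (switch \<pi> u e x) = x"
  proof (cases "x \<in> {u, e, \<pi> u, \<pi> e}")
    case True
    then show ?thesis using sw(1-4) mem assms by auto
  next
    case False
    then have "\<pi> x \<notin> {u, e, \<pi> u, \<pi> e}"
      using mem pairingD(3)[OF assms(1) x] by auto
    then show ?thesis using sw(5) False pairingD[OF assms(1) x] by simp
  qed
qed

lemma pairing_exists:
  assumes "finite S" "even (card S)"
  shows "\<exists>\<pi>. pairing S \<pi>"
  using assms
proof (induction "card S" arbitrary: S rule: less_induct)
  case less
  show ?case
  proof (cases "S = {}")
    case True
    then have "pairing S id" by (simp add: pairing_def)
    then show ?thesis by blast
  next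
    case False
    then obtain x where x: "x \<in> S" by auto
    have "S \<noteq> {x}" using less.prems(2) by auto
    then obtain y where y: "y \<in> S" "y \<noteq> x" using x by blast
    have c: "card S = card (S - {x, y}) + 2"
      using card_Diff_subset[of "{x, y}" S] card_mono[of S "{x, y}"] x y less.prems(1) by auto
    then obtain \<pi> where \<pi>: "pairing (S - {x, y}) \<pi>"
      using less.hyps[of "S - {x, y}"] less.prems by auto
    have "pairing S (\<pi>(x := y, y := x))"
      using \<pi> x y unfolding pairing_def by auto
    then show ?thesis by blast
  qed
qed

section \<open>Counting the pairs of a pairing and the admissible switches\<close>

lemma card_pairs:
  assumes "finite K" "pairing K \<pi>"
  shows "card K = 2 * card ((\<lambda>q. {q, \<pi> q}) ` K)"
proof -
  let ?C = "(\<lambda>q. {q, \<pi> q}) ` K"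
  have "2 * card ?C = card (\<Union> ?C)"
  proof (rule card_partition)
    show "finite ?C" "finite (\<Union> ?C)" using assms(1) by auto
    show "card c = 2" if "c \<in> ?C" for c
      using that pairingD(2)[OF assms(2)] by (auto simp: card_2_iff)
    show "c1 \<inter> c2 = {}" if "c1 \<in> ?C" "c2 \<in> ?C" "c1 \<noteq> c2" for c1 c2
      using that pairingD(3)[OF assms(2)] inj_onD[OF pairing_inj_on[OF assms(2)]] by auto
  qed
  also have "\<Union> ?C = K" using pairingD(1)[OF assms(2)] by auto
  finally show ?thesis by simp
qed

text \<open>The family \<open>C\<close> is indexed by unordered pairs, so \<open>q\<close> and
  \<open>\<pi> q\<close> contribute one set instead of two. As \<open>card K\<close> is even, the
  bound \<open>2 * k + 1\<close> still allows only \<open>k\<close> pairs; thus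
  \<open>card K < 6\<close> gives two pairs.\<close>

lemma card_Union_pairs_le:
  assumes "finite K" "pairing K \<pi>" "card K \<le> 2 * k + 1"
    and "\<And>q. q \<in> K \<Longrightarrow> card (C {q, \<pi> q}) \<le> m"
  shows "card (\<Union>q\<in>K. C {q, \<pi> q}) \<le> k * m"
proof -
  let ?I = "(\<lambda>q. {q, \<pi> q}) ` K"
  have k: "card ?I \<le> k" using card_pairs[OF assms(1,2)] assms(3) by simp
  have "card (\<Union>X\<in>?I. C X) \<le> (\<Sum>X\<in>?I. card (C X))"
    by (rule card_UN_le) (use assms(1) in simp)
  also have "\<dots> \<le> card ?I * m"
    using sum_bounded_above[of ?I "\<lambda>X. card (C X)" m] assms(4) by auto
  also have "\<dots> \<le> k * m" using k by simp
  finally show ?thesis by simp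
qed

text \<open>\<open>E\<close> collects the forbidden new partners of \<open>u\<close> and
  \<open>F\<close> those of \<open>\<pi> u\<close>. A switch with \<open>e\<close> gives
  \<open>\<pi> u\<close> the partner \<open>\<pi> e\<close>, so \<open>F\<close> excludes at most
  \<open>card F\<close> of the \<open>card S - 2\<close> choices of \<open>e\<close>.\<close>

lemma switch_partner_exists:
  assumes "finite S" "pairing S \<pi>" "u \<in> S"
    and "E \<subseteq> S - {u, \<pi> u}" "F \<subseteq> S - {u, \<pi> u}"
    and "card E + card F + 2 < card S"
  shows "\<exists>e\<in>S. e \<noteq> u \<and> e \<noteq> \<pi> u \<and> e \<notin> E \<and> \<pi> e \<notin> F"
proof (rule ccontr)
  assume no: "\<not> ?thesis"
  have fin: "finite E" "finite F" using assms by (meson finite_Diff finite_subset)+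
  have "S - {u, \<pi> u} \<subseteq> E \<union> \<pi> ` F"
  proof
    fix e assume e: "e \<in> S - {u, \<pi> u}"
    then have "e \<in> E \<or> \<pi> e \<in> F" using no by auto
    moreover have "\<pi> (\<pi> e) = e" using pairingD(3)[OF assms(2)] e by simp
    ultimately show "e \<in> E \<union> \<pi> ` F" by (metis UnI1 UnI2 image_eqI)
  qed
  then have "card (S - {u, \<pi> u}) \<le> card (E \<union> \<pi> ` F)"
    by (rule card_mono[rotated]) (use fin in simp)
  also have "\<dots> \<le> card E + card F"
    using card_Un_le[of E "\<pi> ` F"] card_image_le[OF fin(2), of \<pi>] by linarith
  finally have "card (S - {u, \<pi> u}) \<le> card E + card F" .
  moreover have "card (S - {u, \<pi> u}) = card S - 2"
    using card_Diff_subset[of "{u, \<pi> u}" S] pairingD[OF assms(2,3)] assms(3) by simp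
  ultimately show False using assms(6) by linarith
qed

text \<open>A pairing with the fewest vertices \<open>u\<close> satisfying
  \<open>R u (\<pi> u)\<close> has none: otherwise a switch whose two new pairs both avoid
  \<open>R\<close> lowers the number.\<close>

lemma pairing_avoiding:
  assumes "finite S" "even (card S)"
    and sym: "\<And>u v. u \<in> S \<Longrightarrow> v \<in> S \<Longrightarrow> R u v \<Longrightarrow> R v u"
    and deg: "\<And>u. u \<in> S \<Longrightarrow> card {e \<in> S. e \<noteq> u \<and> R u e} \<le> d"
    and "2 * d < card S"
  shows "\<exists>\<pi>. pairing S \<pi> \<and> (\<forall>u\<in>S. \<not> R u (\<pi> u))"
proof -
  let ?f = "\<lambda>\<pi>. card {u \<in> S. R u (\<pi> u)}"
  obtain \<pi>0 where "pairing S \<pi>0" using pairing_exists assms by blast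
  then obtain \<pi> where \<pi>: "pairing S \<pi>" and least: "\<And>\<rho>. pairing S \<rho> \<Longrightarrow> ?f \<pi> \<le> ?f \<rho>"
    using ex_has_least_nat[of "pairing S" \<pi>0 ?f] by blast
  have "\<not> R u (\<pi> u)" if u: "u \<in> S" for u
  proof
    assume R: "R u (\<pi> u)"
    let ?v = "\<pi> u"
    note v = pairingD[OF \<pi> u]
    have Rv: "R ?v u" using sym u v R by blast
    \<comment> \<open>The present partner is itself \<open>R\<close>-related, so removing it leaves
      at most \<open>d - 1\<close> vertices in each set; a switch then needs only
      \<open>2 * (d - 1) + 2 < card S\<close>.\<close>
    let ?E = "{e \<in> S. e \<noteq> u \<and> R u e} - {?v}" and ?F = "{e \<in> S. e \<noteq> ?v \<and> R ?v e} - {u}"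
    have "card ?E < card {e \<in> S. e \<noteq> u \<and> R u e}"
      by (rule card_Diff1_less) (use assms(1) v R in auto)
    moreover have "card ?F < card {e \<in> S. e \<noteq> ?v \<and> R ?v e}"
      by (rule card_Diff1_less) (use assms(1) u v Rv in auto)
    ultimately have "card ?E + card ?F + 2 < card S"
      using deg[OF u] deg[OF v(1)] assms(5) by linarith
    then obtain e where e: "e \<in> S" "e \<noteq> u" "e \<noteq> ?v" "e \<notin> ?E" "\<pi> e \<notin> ?F"
      using switch_partner_exists[OF assms(1) \<pi> u, of ?E ?F] by auto
    note f = pairingD[OF \<pi> e(1)]
    have "\<pi> e \<noteq> u" "\<pi> e \<noteq> ?v" using e f v by metis+
    then have nR: "\<not> R u e" "\<not> R ?v (\<pi> e)" using e f v by auto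
    then have nR': "\<not> R e u" "\<not> R (\<pi> e) ?v" using sym e f u v by blast+
    note sw = switch_simps[OF \<pi> u e(1-3)]
    have "{x \<in> S. R x (switch \<pi> u e x)} \<subset> {x \<in> S. R x (\<pi> x)}"
    proof
      show "{x \<in> S. R x (switch \<pi> u e x)} \<subseteq> {x \<in> S. R x (\<pi> x)}"
      proof safe
        fix x assume "x \<in> S" and Rx: "R x (switch \<pi> u e x)"
        have "x \<notin> {u, e, ?v, \<pi> e}" using Rx nR nR' sw(1-4) by auto
        then show "R x (\<pi> x)" using Rx sw(5) by simp
      qed
      show "{x \<in> S. R x (switch \<pi> u e x)} \<noteq> {x \<in> S. R x (\<pi> x)}"
        using u R nR sw(1) by force
    qed
    then have "?f (switch \<pi> u e) < ?f \<pi>"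
      by (rule psubset_card_mono[rotated]) (use assms(1) in simp)
    then show False using least[OF pairing_switch[OF \<pi> u e(1-3)]] by simp
  qed
  then show ?thesis using \<pi> by blast
qed

text \<open>In the application \<open>R\<close> records adjacency and all conflicts with pairs
  outside \<open>W\<close>, so only 4-cycles between two pairs of \<open>W\<close> remain to be
  destroyed. Among the pairings avoiding \<open>R\<close>, one with the fewest bad vertices is
  taken. Each end of a bad pair excludes at most 22 + 5 partners, one of them its present partner,
  and 26 + 26 + 2 < 56.\<close>

lemma pairing_without_4cycle:
  fixes N :: "'a \<Rightarrow> 'a set" and R :: "'a \<Rightarrow> 'a \<Rightarrow> bool"
  assumes W: "finite W" "card W = 56"
    and symN: "\<And>x y. x \<in> W \<Longrightarrow> y \<in> W \<Longrightarrow> y \<in> N x \<Longrightarrow> x \<in> N y"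
    and irrefl: "\<And>x. x \<in> W \<Longrightarrow> x \<notin> N x"
    and symR: "\<And>x y. x \<in> W \<Longrightarrow> y \<in> W \<Longrightarrow> R x y \<Longrightarrow> R y x"
    and NR: "\<And>x y. x \<in> W \<Longrightarrow> y \<in> W \<Longrightarrow> y \<in> N x \<Longrightarrow> R x y"
    and degR: "\<And>u. u \<in> W \<Longrightarrow> card {e \<in> W. e \<noteq> u \<and> R u e} \<le> 22"
    and degN: "\<And>u. u \<in> W \<Longrightarrow> card (N u \<inter> W) \<le> 10"
    and common: "\<And>u v. u \<in> W \<Longrightarrow> v \<in> W \<Longrightarrow> u \<noteq> v \<Longrightarrow> v \<notin> N u \<Longrightarrow> card (N u \<inter> N v \<inter> W) \<le> 2"
  shows "\<exists>\<pi>. pairing W \<pi> \<and> (\<forall>u\<in>W. \<not> R u (\<pi> u)) \<and>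
    (\<forall>u\<in>W. \<forall>z\<in>W. \<not> {z, \<pi> z} \<subseteq> N u \<inter> N (\<pi> u))"
proof -
  let ?ok = "\<lambda>\<pi>. pairing W \<pi> \<and> (\<forall>u\<in>W. \<not> R u (\<pi> u))"
  let ?bad = "\<lambda>\<pi>. {u \<in> W. \<exists>z\<in>W. {z, \<pi> z} \<subseteq> N u \<inter> N (\<pi> u)}"
  have "\<exists>\<pi>. ?ok \<pi>"
    by (rule pairing_avoiding[where d = 22]) (use W symR degR in auto)
  then obtain \<pi>0 where "?ok \<pi>0" by blast
  then obtain \<pi> where \<pi>: "pairing W \<pi>" and \<pi>R: "\<And>u. u \<in> W \<Longrightarrow> \<not> R u (\<pi> u)"
    and least: "\<And>\<rho>. ?ok \<rho> \<Longrightarrow> card (?bad \<pi>) \<le> card (?bad \<rho>)"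
    using ex_has_least_nat[of ?ok \<pi>0 "\<lambda>\<pi>. card (?bad \<pi>)"] by auto
  let ?C = "\<lambda>u. {e \<in> W. e \<noteq> u \<and> (\<exists>z\<in>W. {z, \<pi> z} \<subseteq> N u \<inter> N e)}"
  \<comment> \<open>At most ten neighbours of \<open>u\<close> form at most five pairs inside
    \<open>N u\<close>. Such a pair is nonadjacent, so it has at most two common neighbours in
    \<open>W\<close>; one is \<open>u\<close>, which leaves at most one other.\<close>
  have C5: "card (?C u) \<le> 5" if u: "u \<in> W" for u
  proof -
    define K where "K = {z \<in> N u \<inter> W. \<pi> z \<in> N u}"
    define D where "D = (\<lambda>X. {e \<in> W. e \<noteq> u \<and> X \<subseteq> N e})"
    have finK: "finite K" using W by (simp add: K_def)
    have "card K \<le> card (N u \<inter> W)" by (rule card_mono) (use W in \<open>auto simp: K_def\<close>)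
    then have K10: "card K \<le> 2 * 5 + 1" using degN[OF u] by simp
    have K: "pairing K \<pi>" using \<pi> by (auto simp: pairing_def K_def)
    have D1: "card (D {z, \<pi> z}) \<le> 1" if z: "z \<in> K" for z
    proof -
      have zW: "z \<in> W" "\<pi> z \<in> W" "\<pi> z \<noteq> z" using z pairingD[OF \<pi>] by (auto simp: K_def)
      have "\<pi> z \<notin> N z" using NR \<pi>R zW by blast
      then have le: "card (N z \<inter> N (\<pi> z) \<inter> W) \<le> 2" using common zW by metis
      have fin: "finite (D {z, \<pi> z})" using W by (simp add: D_def)
      have "insert u (D {z, \<pi> z}) \<subseteq> N z \<inter> N (\<pi> z) \<inter> W"
        using z u symN zW by (auto simp: D_def K_def)
      then have "card (insert u (D {z, \<pi> z})) \<le> card (N z \<inter> N (\<pi> z) \<inter> W)"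
        by (rule card_mono[rotated]) (use W in simp)
      moreover have "u \<notin> D {z, \<pi> z}" by (simp add: D_def)
      ultimately show ?thesis using le fin by simp
    qed
    have "?C u \<subseteq> (\<Union>z\<in>K. D {z, \<pi> z})" by (auto simp: D_def K_def)
    then have "card (?C u) \<le> card (\<Union>z\<in>K. D {z, \<pi> z})"
      by (rule card_mono[rotated]) (use W finK in \<open>simp add: D_def\<close>)
    also have "\<dots> \<le> 5 * 1" by (rule card_Union_pairs_le[where C = D, OF finK K K10 D1])
    finally show ?thesis by simp
  qed
  have "?bad \<pi> = {}"
  proof (rule ccontr)
    assume "?bad \<pi> \<noteq> {}"
    then obtain u where u: "u \<in> W" and ubad: "\<exists>z\<in>W. {z, \<pi> z} \<subseteq> N u \<inter> N (\<pi> u)" by blast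
    let ?v = "\<pi> u"
    note v = pairingD[OF \<pi> u]
    let ?X = "\<lambda>u. {e \<in> W. e \<noteq> u \<and> R u e} \<union> ?C u"
    have X27: "card (?X u) \<le> 27" if "u \<in> W" for u
      using card_Un_le[of "{e \<in> W. e \<noteq> u \<and> R u e}" "?C u"] C5[OF that] degR[OF that] by linarith
    \<comment> \<open>The partner of a bad vertex is among the excluded vertices, which gains the decisive unit.\<close>
    have "card (?X u - {?v}) < card (?X u)"
      by (rule card_Diff1_less) (use W ubad v in auto)
    moreover have "card (?X ?v - {u}) < card (?X ?v)"
      by (rule card_Diff1_less) (use W ubad u v in auto)
    ultimately have "card (?X u - {?v}) + card (?X ?v - {u}) + 2 < card W"
      using X27[OF u] X27[OF v(1)] W by linarith
    moreover have "?X u - {?v} \<subseteq> W - {u, ?v}" "?X ?v - {u} \<subseteq> W - {u, ?v}" by auto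
    ultimately obtain e where e: "e \<in> W" "e \<noteq> u" "e \<noteq> ?v" "e \<notin> ?X u - {?v}" "\<pi> e \<notin> ?X ?v - {u}"
      using switch_partner_exists[OF W(1) \<pi> u, of "?X u - {?v}" "?X ?v - {u}"] by blast
    note f = pairingD[OF \<pi> e(1)]
    have fne: "\<pi> e \<noteq> u" "\<pi> e \<noteq> ?v" using e f v by metis+
    note sw = switch_simps[OF \<pi> u e(1-3)]
    let ?\<rho> = "switch \<pi> u e"
    have \<rho>: "pairing W ?\<rho>" by (rule pairing_switch[OF \<pi> u e(1-3)])
    have nR: "\<not> R u e" "\<not> R ?v (\<pi> e)" using e f v fne by auto
    then have nR': "\<not> R e u" "\<not> R (\<pi> e) ?v" using symR e f u v by blast+
    have nC: "\<not> {z, \<pi> z} \<subseteq> N u \<inter> N e" "\<not> {z, \<pi> z} \<subseteq> N ?v \<inter> N (\<pi> e)" if "z \<in> W" for z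
      using e f fne that by auto
    have \<rho>R: "\<not> R q (?\<rho> q)" if "q \<in> W" for q
    proof (cases "q \<in> {u, e, ?v, \<pi> e}")
      case True then show ?thesis using sw(1-4) nR nR' by auto
    next
      case False then show ?thesis using sw(5) \<pi>R that by simp
    qed
    have uv: "?v \<notin> N u" "u \<notin> N ?v" "\<pi> e \<notin> N e" "e \<notin> N (\<pi> e)"
      using NR \<pi>R[OF u] \<pi>R[OF e(1)] symN u v e f by blast+
    \<comment> \<open>A new pair in the role of \<open>{z, ?\<rho> z}\<close> is harmless:
      \<open>{u, e}\<close> would need \<open>u\<close> in \<open>N u\<close>, and
      \<open>{?v, \<pi> e}\<close> would need \<open>?v\<close> in \<open>N u\<close>, although old
      partners are nonadjacent.\<close>
    have ueN: "\<not> {z, ?\<rho> z} \<subseteq> N u \<inter> N e" if "z \<in> W" for z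
    proof (cases "z \<in> {u, e, ?v, \<pi> e}")
      case True then show ?thesis using sw(1-4) irrefl u e(1) uv by auto
    next
      case False then show ?thesis using sw(5) nC that by simp
    qed
    have vfN: "\<not> {z, ?\<rho> z} \<subseteq> N ?v \<inter> N (\<pi> e)" if "z \<in> W" for z
    proof (cases "z \<in> {u, e, ?v, \<pi> e}")
      case True then show ?thesis using sw(1-4) irrefl v(1) f(1) uv by auto
    next
      case False then show ?thesis using sw(5) nC that by simp
    qed
    have new: "\<not> {z, ?\<rho> z} \<subseteq> N y \<inter> N (?\<rho> y)" if "y \<in> {u, e, ?v, \<pi> e}" "z \<in> W" for y z
      using ueN[OF that(2)] vfN[OF that(2)] that(1) sw(1-4) by (auto simp: Int_commute)
    have "?bad ?\<rho> \<subset> ?bad \<pi>"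
    proof
      show "?bad ?\<rho> \<subseteq> ?bad \<pi>"
      proof
        fix y assume "y \<in> ?bad ?\<rho>"
        then obtain z where y: "y \<in> W" and z: "z \<in> W" "{z, ?\<rho> z} \<subseteq> N y \<inter> N (?\<rho> y)" by blast
        have y': "y \<notin> {u, e, ?v, \<pi> e}" using new z by blast
        \<comment> \<open>Conflict is symmetric in the two pairs, so \<open>z\<close> too lies
          outside the switched pairs and the conflict was already present under
          \<open>\<pi>\<close>.\<close>
        have "{y, ?\<rho> y} \<subseteq> N z \<inter> N (?\<rho> z)"
          using z y symN pairingD(1)[OF \<rho>] by auto
        then have "z \<notin> {u, e, ?v, \<pi> e}" using new y by blast
        then have "{z, \<pi> z} \<subseteq> N y \<inter> N (\<pi> y)" using z(2) sw(5) y' by simp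
        then show "y \<in> ?bad \<pi>" using y z(1) by blast
      qed
      show "?bad ?\<rho> \<noteq> ?bad \<pi>" using u ubad new[of u] by blast
    qed
    then have "card (?bad ?\<rho>) < card (?bad \<pi>)"
      by (rule psubset_card_mono[rotated]) (use W in simp)
    then show False using least[of ?\<rho>] \<rho> \<rho>R by force
  qed
  then show ?thesis using \<pi> \<pi>R by blast
qed

section \<open>Strongly regular graphs with parameters (100,22,0,6)\<close>

locale srg_100_22_0_6 =
  fixes V :: "'a set" and N :: "'a \<Rightarrow> 'a set"
  assumes card_V: "card V = 100"
    and N_sub: "x \<in> V \<Longrightarrow> N x \<subseteq> V"
    and N_sym: "x \<in> V \<Longrightarrow> y \<in> N x \<Longrightarrow> x \<in> N y"
    and card_N: "x \<in> V \<Longrightarrow> card (N x) = 22"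
    and triangle_free: "x \<in> V \<Longrightarrow> y \<in> N x \<Longrightarrow> N x \<inter> N y = {}"
    and card_common: "x \<in> V \<Longrightarrow> y \<in> V \<Longrightarrow> x \<noteq> y \<Longrightarrow> y \<notin> N x \<Longrightarrow> card (N x \<inter> N y) = 6"
begin

section \<open>Neighbourhoods and common neighbours of triples\<close>

lemma finite_V: "finite V"
  using card_V by (simp add: card_ge_0_finite)

lemma finite_N: "x \<in> V \<Longrightarrow> finite (N x)"
  using N_sub finite_V finite_subset by blast

lemma N_in_V: "x \<in> V \<Longrightarrow> y \<in> N x \<Longrightarrow> y \<in> V"
  using N_sub by blast

lemma N_sym_iff: "x \<in> V \<Longrightarrow> y \<in> V \<Longrightarrow> y \<in> N x \<longleftrightarrow> x \<in> N y"
  using N_sym by blast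

lemma N_irrefl: "x \<in> V \<Longrightarrow> x \<notin> N x"
  using triangle_free by blast

lemma N_no_triangle: "x \<in> V \<Longrightarrow> y \<in> N x \<Longrightarrow> z \<in> N x \<Longrightarrow> z \<notin> N y"
  using triangle_free by blast

text \<open>A variance argument. With \<open>X\<close> the six common neighbours of \<open>x\<close>
  and \<open>y\<close>, and \<open>U\<close> the 60 vertices outside \<open>x\<close>,
  \<open>y\<close> and their neighbourhoods, the numbers \<open>card (N w \<inter> X)\<close> for
  \<open>w\<close> in \<open>U\<close> have sum 120 and square sum 240, so all of them equal 2;
  \<open>z\<close> is one such \<open>w\<close>.\<close>

lemma common_neighbours_of_three:
  assumes V: "x \<in> V" "y \<in> V" "z \<in> V" and ne: "x \<noteq> y" "x \<noteq> z" "y \<noteq> z"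
    and na: "y \<notin> N x" "z \<notin> N x" "z \<notin> N y"
  shows "card (N x \<inter> N y \<inter> N z) = 2"
proof -
  define X where "X = N x \<inter> N y"
  define U where "U = V - ({x, y} \<union> (N x \<union> N y))"
  define i where "i = (\<lambda>w. card (N w \<inter> X))"
  have X6: "card X = 6" using card_common[OF V(1,2) ne(1) na(1)] by (simp add: X_def)
  have XV: "p \<in> V" if "p \<in> X" for p using that N_in_V V by (auto simp: X_def)
  have finX: "finite X" using X6 by (simp add: card_ge_0_finite)
  have finU: "finite U" using finite_V by (simp add: U_def)
  have "card (N x \<union> N y) = 38"
    using card_Un_Int[OF finite_N[OF V(1)] finite_N[OF V(2)]] card_N V X6 by (simp add: X_def)
  moreover have "x \<notin> N y" using na(1) V N_sym by blast
  ultimately have "card ({x, y} \<union> (N x \<union> N y)) = 40"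
    using ne(1) na(1) N_irrefl V finite_N by (subst card_Un_disjoint) auto
  moreover have "card U = card V - card ({x, y} \<union> (N x \<union> N y))"
    unfolding U_def by (rule card_Diff_subset) (use V N_sub finite_N in auto)
  ultimately have U60: "card U = 60" using card_V by simp
  \<comment> \<open>By triangle-freeness a neighbour of a vertex of \<open>X\<close> is never in
    \<open>N x\<close> or \<open>N y\<close>, so restricting to \<open>U\<close> removes only
    \<open>x\<close> and \<open>y\<close>: 22 and 6 become 20 and 4.\<close>
  have common_U: "N p \<inter> N q \<inter> U = N p \<inter> N q - {x, y}" if "p \<in> X" "q \<in> X" for p q
  proof -
    have "N p \<inter> N x = {}" "N p \<inter> N y = {}"
      using triangle_free V that unfolding X_def by blast+
    then show ?thesis using N_sub[OF XV[OF that(1)]] by (auto simp: U_def)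
  qed
  have card_common_U: "card (N p \<inter> N q \<inter> U) = (if p = q then 20 else 4)"
    if pq: "p \<in> X" "q \<in> X" for p q
  proof -
    have xy: "{x, y} \<subseteq> N p \<inter> N q" using pq V N_sym by (auto simp: X_def)
    have "card (N p \<inter> N q) = (if p = q then 22 else 6)"
    proof (cases "p = q")
      case True then show ?thesis using card_N XV pq by simp
    next
      case False
      have "q \<notin> N p" using N_no_triangle[OF V(1)] pq by (auto simp: X_def)
      then show ?thesis using card_common XV pq False by simp
    qed
    then show ?thesis
      using common_U[OF pq] xy ne(1) by (simp add: card_Diff_subset)
  qed
  define b where "b = (\<lambda>w p. if w \<in> N p then 1 else 0 :: nat)"
  have i_sum: "i w = (\<Sum>p\<in>X. b w p)" if "w \<in> U" for w
  proof -
    have "N w \<inter> X = {p \<in> X. w \<in> N p}" using N_sym_iff XV that by (auto simp: U_def)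
    then show ?thesis using finX by (simp add: i_def b_def sum.If_cases Int_def)
  qed
  have b_sum: "(\<Sum>w\<in>U. b w p * b w q) = card (N p \<inter> N q \<inter> U)" for p q
  proof -
    have "(\<Sum>w\<in>U. b w p * b w q) = (\<Sum>w\<in>U. if w \<in> N p \<inter> N q then 1 else 0)"
      by (rule sum.cong) (auto simp: b_def)
    also have "\<dots> = card (U \<inter> (N p \<inter> N q))" using finU by (simp add: sum.If_cases Int_def)
    finally show ?thesis by (simp add: Int_commute)
  qed
  have "(\<Sum>w\<in>U. i w) = (\<Sum>w\<in>U. \<Sum>p\<in>X. b w p * b w p)"
    by (intro sum.cong) (auto simp: i_sum b_def intro!: sum.cong)
  also have "\<dots> = (\<Sum>p\<in>X. \<Sum>w\<in>U. b w p * b w p)" by (rule sum.swap)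
  also have "\<dots> = (\<Sum>p\<in>X. 20)"
    by (intro sum.cong refl) (simp only: b_sum card_common_U refl if_True)
  finally have sum1: "(\<Sum>w\<in>U. i w) = 120" using X6 by simp
  have "(\<Sum>w\<in>U. i w * i w) = (\<Sum>w\<in>U. \<Sum>p\<in>X. \<Sum>q\<in>X. b w p * b w q)"
    by (intro sum.cong refl) (simp add: i_sum sum_product)
  also have "\<dots> = (\<Sum>p\<in>X. \<Sum>w\<in>U. \<Sum>q\<in>X. b w p * b w q)" by (rule sum.swap)
  also have "\<dots> = (\<Sum>p\<in>X. \<Sum>q\<in>X. \<Sum>w\<in>U. b w p * b w q)"
    by (intro sum.cong refl sum.swap)
  \<comment> \<open>The diagonal value 20 is written as 4 + 16, so the double sum is 36 * 4 + 6 *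
    16.\<close>
  also have "\<dots> = (\<Sum>p\<in>X. \<Sum>q\<in>X. 4 + (if p = q then 16 else 0))"
    by (intro sum.cong refl) (simp add: b_sum card_common_U)
  finally have sum2: "(\<Sum>w\<in>U. i w * i w) = 240"
    using finX X6 by (simp add: sum.distrib)
  \<comment> \<open>The intersection numbers have mean 2 and variance 0.\<close>
  have "(\<Sum>w\<in>U. (int (i w) - 2)\<^sup>2) = (\<Sum>w\<in>U. int (i w * i w) + (4 - 4 * int (i w)))"
    by (intro sum.cong refl) (simp add: power2_eq_square algebra_simps)
  also have "\<dots> = int (\<Sum>w\<in>U. i w * i w) + (4 * int (card U) - 4 * int (\<Sum>w\<in>U. i w))"
    by (simp add: sum.distrib sum_subtractf sum_distrib_left)
  also have "\<dots> = 0" by (simp add: sum1 sum2 U60 del: of_nat_sum)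
  finally have "\<forall>w\<in>U. (int (i w) - 2)\<^sup>2 = 0"
    using finU by (subst (asm) sum_nonneg_eq_0_iff) auto
  moreover have "z \<in> U" using V ne na by (auto simp: U_def)
  ultimately have "i z = 2" by simp
  then show ?thesis by (simp add: i_def X_def Int_commute)
qed

lemma common_neighbours_le_2:
  assumes "x \<in> V" "y \<in> V" "z \<in> V" "x \<noteq> y" "x \<noteq> z" "y \<noteq> z"
  shows "card (N x \<inter> N y \<inter> N z) \<le> 2"
proof (cases "y \<in> N x \<or> z \<in> N x \<or> z \<in> N y")
  case True
  then have "N x \<inter> N y \<inter> N z = {}" using triangle_free assms(1,2) by blast
  then show ?thesis by simp
next
  case False
  then show ?thesis using common_neighbours_of_three assms by simp
qed

section \<open>Pairing the neighbourhood of a vertex\<close>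

text \<open>\<open>full a S \<pi> w\<close>: the six common neighbours of \<open>a\<close> and \<open>w\<close> split into three pairs of \<open>\<pi>\<close>;
  \<open>completes a S \<pi> u e\<close>: adding the pair \<open>{u, e}\<close> would create such a \<open>w\<close>.\<close>

definition full :: "'a \<Rightarrow> 'a set \<Rightarrow> ('a \<Rightarrow> 'a) \<Rightarrow> 'a \<Rightarrow> bool" where
  "full a S \<pi> w \<longleftrightarrow> w \<in> V \<and> w \<noteq> a \<and> w \<notin> N a \<and> (\<forall>q \<in> N w \<inter> N a. q \<in> S \<and> \<pi> q \<in> N w)"

definition completes :: "'a \<Rightarrow> 'a set \<Rightarrow> ('a \<Rightarrow> 'a) \<Rightarrow> 'a \<Rightarrow> 'a \<Rightarrow> bool" where
  "completes a S \<pi> u e \<longleftrightarrow> (\<exists>w\<in>V. w \<noteq> a \<and> w \<notin> N a \<and> u \<in> N w \<and> e \<in> N w \<and>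
     (\<forall>q \<in> N w \<inter> N a - {u, e}. q \<in> S \<and> \<pi> q \<in> N w - {u, e}))"

text \<open>Each such \<open>e\<close> has a witness \<open>w\<close> whose four remaining common
  neighbours with \<open>a\<close> form two pairs of \<open>\<pi>\<close> inside
  \<open>S - {u, \<pi> u}\<close>. These 4-sets are disjoint for different \<open>e\<close>, and 18
  points hold at most four of them.\<close>

lemma card_completes_le:
  assumes a: "a \<in> V" and S: "S \<subseteq> N a" "card S = 20" and \<pi>: "pairing S \<pi>" and u: "u \<in> S"
  shows "card {e \<in> S - {u, \<pi> u}. completes a S \<pi> u e} \<le> 4"
proof -
  let ?E = "{e \<in> S - {u, \<pi> u}. completes a S \<pi> u e}"
  have finS: "finite S" using finite_N[OF a] S(1) finite_subset by blast
  have "\<forall>e\<in>?E. \<exists>w. w \<in> V \<and> w \<noteq> a \<and> w \<notin> N a \<and> u \<in> N w \<and> e \<in> N w \<and>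
     (\<forall>q \<in> N w \<inter> N a - {u, e}. q \<in> S \<and> \<pi> q \<in> N w - {u, e})"
    unfolding completes_def by blast
  from bchoice[OF this] obtain w where w: "\<And>e. e \<in> ?E \<Longrightarrow> w e \<in> V \<and> w e \<noteq> a \<and> w e \<notin> N a \<and> u \<in> N (w e) \<and>
      e \<in> N (w e) \<and> (\<forall>q \<in> N (w e) \<inter> N a - {u, e}. q \<in> S \<and> \<pi> q \<in> N (w e) - {u, e})"
    by blast
  define A where "A = (\<lambda>e. N (w e) \<inter> N a - {u, e})"
  have AS: "A e \<subseteq> S" if "e \<in> ?E" for e
    using w[OF that] by (auto simp: A_def)
  have A\<pi>: "\<pi> q \<in> A e" if "e \<in> ?E" "q \<in> A e" for e q
    using w[OF that(1)] that(2) pairingD(1)[OF \<pi>] S(1) unfolding A_def by blast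
  have cardA: "card (A e) = 4" if "e \<in> ?E" for e
  proof -
    have "card (N (w e) \<inter> N a) = 6"
      using w[OF that] a card_common N_sym_iff by auto
    moreover have "{u, e} \<subseteq> N (w e) \<inter> N a" using w[OF that] that u S(1) by auto
    ultimately show ?thesis using that by (auto simp: A_def card_Diff_subset)
  qed
  \<comment> \<open>A pair in two of these sets would give, with \<open>u\<close>, three common neighbours of three vertices.\<close>
  have disj: "A e \<inter> A e' = {}" if e: "e \<in> ?E" "e' \<in> ?E" "e \<noteq> e'" for e e'
  proof (rule ccontr)
    assume "A e \<inter> A e' \<noteq> {}"
    then obtain q where q: "q \<in> A e" "q \<in> A e'" by auto
    have qS: "q \<in> S" using AS e q by blast
    have r: "\<pi> q \<in> A e" "\<pi> q \<in> A e'" using A\<pi> e q by auto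
    show False
    proof (cases "w e = w e'")
      case True
      \<comment> \<open>With a common witness, \<open>e'\<close> lies in the
        \<open>\<pi>\<close>-closed set \<open>A e\<close>. Its partner then lies in
        \<open>A e'\<close>, and closure of that set forces \<open>e'\<close> into it, although it
        omits \<open>e'\<close>.\<close>
      have "e' \<in> A e" using w[OF e(2)] e True S(1) by (auto simp: A_def)
      moreover from this have "\<pi> e' \<in> A e" using A\<pi> e by simp
      moreover have "\<pi> e' \<noteq> e'" using pairingD(2)[OF \<pi>] e by auto
      ultimately have "\<pi> e' \<in> A e'" using True by (auto simp: A_def)
      then have "\<pi> (\<pi> e') \<in> A e'" using A\<pi> e by simp
      then have "e' \<in> A e'" using pairingD(3)[OF \<pi>] e by simp
      then show False by (simp add: A_def)
    next
      case False
      have fin: "finite (N (w e) \<inter> N (w e') \<inter> N a)" using finite_N[OF a] by simp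
      have "card {u, q, \<pi> q} = 3"
        using q r pairingD(2)[OF \<pi> qS] by (auto simp: A_def)
      moreover have "{u, q, \<pi> q} \<subseteq> N (w e) \<inter> N (w e') \<inter> N a"
        using q r w[OF e(1)] w[OF e(2)] u S(1) by (auto simp: A_def)
      ultimately have "3 \<le> card (N (w e) \<inter> N (w e') \<inter> N a)"
        using card_mono[OF fin] by metis
      moreover have "card (N (w e) \<inter> N (w e') \<inter> N a) \<le> 2"
        using common_neighbours_le_2 False w[OF e(1)] w[OF e(2)] a by auto
      ultimately show False by simp
    qed
  qed
  have "\<pi> u \<notin> A e" if "e \<in> ?E" for e
    using A\<pi>[OF that, of "\<pi> u"] pairingD(3)[OF \<pi> u] by (auto simp: A_def)
  then have "(\<Union>e\<in>?E. A e) \<subseteq> S - {u, \<pi> u}" using AS by (fastforce simp: A_def)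
  then have "card (\<Union>e\<in>?E. A e) \<le> card (S - {u, \<pi> u})"
    by (rule card_mono[rotated]) (use finS in simp)
  also have "\<dots> = 18"
    using pairingD[OF \<pi> u] u S(2) by (simp add: card_Diff_subset)
  also have "card (\<Union>e\<in>?E. A e) = (\<Sum>e\<in>?E. card (A e))"
  proof (rule card_UN_disjoint)
    show "finite ?E" using finS by simp
    show "\<forall>e\<in>?E. finite (A e)" using AS finS finite_subset by blast
    show "\<forall>e\<in>?E. \<forall>e'\<in>?E. e \<noteq> e' \<longrightarrow> A e \<inter> A e' = {}" using disj by blast
  qed
  also have "\<dots> = card ?E * 4" using cardA by simp
  finally show ?thesis by linarith
qed

text \<open>\<open>T\<close> will be the neighbourhood of the vertex paired with \<open>a\<close>,
  so no pair may lie inside it. Among such pairings one with the fewest full vertices is taken; a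
  full vertex supplies a pair whose switching destroys it without making another vertex
  full.\<close>

lemma pairing_without_full:
  assumes a: "a \<in> V" and S: "S \<subseteq> N a" "card S = 20" and T: "card (S \<inter> T) \<le> 5"
  shows "\<exists>\<pi>. pairing S \<pi> \<and> (\<forall>q\<in>S. \<not> (q \<in> T \<and> \<pi> q \<in> T)) \<and> (\<forall>w. \<not> full a S \<pi> w)"
proof -
  have finS: "finite S" using finite_N[OF a] S(1) finite_subset by blast
  let ?ok = "\<lambda>\<pi>. pairing S \<pi> \<and> (\<forall>q\<in>S. \<not> (q \<in> T \<and> \<pi> q \<in> T))"
  let ?f = "\<lambda>\<pi>. card {w. full a S \<pi> w}"
  have T4: "card {e \<in> S. e \<noteq> u \<and> u \<in> T \<and> e \<in> T} \<le> (if u \<in> T then 4 else 0)" if "u \<in> S" for u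
  proof (cases "u \<in> T")
    case True
    have "card (S \<inter> T - {u}) < card (S \<inter> T)"
      by (rule card_Diff1_less) (use True that finS in auto)
    moreover have "{e \<in> S. e \<noteq> u \<and> u \<in> T \<and> e \<in> T} = S \<inter> T - {u}" using True by auto
    ultimately show ?thesis using T True by simp
  qed auto
  have "\<exists>\<pi>. ?ok \<pi>"
    by (rule pairing_avoiding[where d = 4]) (use finS S T4 in \<open>fastforce split: if_splits\<close>)+
  then obtain \<pi>0 where "?ok \<pi>0" by blast
  then obtain \<pi> where \<pi>: "pairing S \<pi>" and \<pi>T: "\<And>q. q \<in> S \<Longrightarrow> \<not> (q \<in> T \<and> \<pi> q \<in> T)"
    and least: "\<And>\<rho>. ?ok \<rho> \<Longrightarrow> ?f \<pi> \<le> ?f \<rho>"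
    using ex_has_least_nat[of ?ok \<pi>0 ?f] by auto
  have "\<not> full a S \<pi> w" for w
  proof
    assume full: "full a S \<pi> w"
    then have w: "w \<in> V" "w \<noteq> a" "w \<notin> N a"
      and wS: "\<And>q. q \<in> N w \<inter> N a \<Longrightarrow> q \<in> S \<and> \<pi> q \<in> N w" by (auto simp: full_def)
    have w6: "card (N w \<inter> N a) = 6" using card_common w a N_sym_iff by auto
    then have "N w \<inter> N a \<noteq> {}" by force
    then obtain u where uw: "u \<in> N w \<inter> N a" by blast
    then have u: "u \<in> S" using wS by blast
    let ?v = "\<pi> u"
    note v = pairingD[OF \<pi> u]
    have vw: "?v \<in> N w \<inter> N a" using wS[OF uw] v S(1) by blast
    let ?T = "\<lambda>u. {e \<in> S. e \<noteq> u \<and> u \<in> T \<and> e \<in> T}"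
    let ?C = "\<lambda>u. {e \<in> S - {u, \<pi> u}. completes a S \<pi> u e}"
    \<comment> \<open>Excluding the other four common neighbours of \<open>w\<close> and
      \<open>a\<close> ensures that \<open>w\<close> stops being full; the sets \<open>?C\<close>
      prevent new full vertices, and the sets \<open>?T\<close> prevent new pairs inside
      \<open>T\<close>.\<close>
    let ?E = "(N w \<inter> N a - {u, ?v}) \<union> (?C u \<union> ?T u)" and ?F = "?C ?v \<union> ?T ?v"
    have "card (N w \<inter> N a - {u, ?v}) = 4"
      using w6 uw vw v(2) by (simp add: card_Diff_subset)
    then have "card ?E \<le> 8 + (if u \<in> T then 4 else 0)"
      using card_Un_le[of "N w \<inter> N a - {u, ?v}" "?C u \<union> ?T u"] card_Un_le[of "?C u" "?T u"]
        T4[OF u] card_completes_le[OF a S \<pi> u] by linarith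
    moreover have "card ?F \<le> 4 + (if ?v \<in> T then 4 else 0)"
      using card_Un_le[of "?C ?v" "?T ?v"] T4[OF v(1)] card_completes_le[OF a S \<pi> v(1)]
      by linarith
    \<comment> \<open>At most one of the partners lies in \<open>T\<close>, so at most 12 + 4 of the 18 candidates are lost.\<close>
    ultimately have "card ?E + card ?F + 2 < card S" using \<pi>T[OF u] S(2) by (auto split: if_splits)
    moreover have "?E \<subseteq> S - {u, ?v}" using wS \<pi>T[OF u] by auto
    moreover have "?F \<subseteq> S - {u, ?v}" using \<pi>T[OF u] v by auto
    ultimately obtain e where e: "e \<in> S" "e \<noteq> u" "e \<noteq> ?v" "e \<notin> ?E" "\<pi> e \<notin> ?F"
      using switch_partner_exists[OF finS \<pi> u, of ?E ?F] by blast
    note f = pairingD[OF \<pi> e(1)]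
    have fne: "\<pi> e \<noteq> u" "\<pi> e \<noteq> ?v" using e f v by metis+
    note sw = switch_simps[OF \<pi> u e(1-3)]
    let ?\<rho> = "switch \<pi> u e"
    have ncu: "\<not> completes a S \<pi> u e" using e by auto
    have ncv: "\<not> completes a S \<pi> ?v (\<pi> e)" using e f v fne by auto
    have nw: "e \<notin> N w" using e S(1) by auto
    have nT: "\<not> (u \<in> T \<and> e \<in> T)" "\<not> (?v \<in> T \<and> \<pi> e \<in> T)" using e f fne by auto
    have "?ok ?\<rho>"
    proof (intro conjI ballI)
      show "pairing S ?\<rho>" by (rule pairing_switch[OF \<pi> u e(1-3)])
      fix q assume "q \<in> S"
      show "\<not> (q \<in> T \<and> ?\<rho> q \<in> T)"
      proof (cases "q \<in> {u, e, ?v, \<pi> e}")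
        case True then show ?thesis using sw(1-4) nT by auto
      next
        case False then show ?thesis using sw(5) \<pi>T \<open>q \<in> S\<close> by simp
      qed
    qed
    moreover have "?f ?\<rho> < ?f \<pi>"
    proof (rule psubset_card_mono)
      show "finite {w. full a S \<pi> w}"
        by (rule finite_subset[OF _ finite_V]) (auto simp: full_def)
      \<comment> \<open>If \<open>N w'\<close> contains both new pairs, it contains both old ones;
        if it contains neither, nothing changed; exactly one is the case that
        \<open>completes\<close> excludes.\<close>
      have "full a S \<pi> w'" if full': "full a S ?\<rho> w'" for w'
      proof -
        let ?K = "N w' \<inter> N a"
        have w': "w' \<in> V" "w' \<noteq> a" "w' \<notin> N a"
          and K: "\<And>q. q \<in> ?K \<Longrightarrow> q \<in> S \<and> ?\<rho> q \<in> N w'" using full' by (auto simp: full_def)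
        have K': "?\<rho> q \<in> ?K" if "q \<in> ?K" for q
          using K[OF that] pairingD(1)[OF pairing_switch[OF \<pi> u e(1-3)], of q] S(1) by auto
        have ue: "u \<in> ?K \<longleftrightarrow> e \<in> ?K" using K'[of u, unfolded sw(1)] K'[of e, unfolded sw(2)] by blast
        have vf: "?v \<in> ?K \<longleftrightarrow> \<pi> e \<in> ?K" using K'[of ?v, unfolded sw(3)] K'[of "\<pi> e", unfolded sw(4)] by blast
        have old: "q \<in> S \<and> \<pi> q \<in> ?K \<and> \<pi> q \<notin> {u, e, ?v, \<pi> e}"
          if q: "q \<in> ?K" "q \<notin> {u, e, ?v, \<pi> e}" for q
        proof -
          have "q \<in> S" using K q by blast
          moreover have "\<pi> q \<in> ?K" using K'[OF q(1)] sw(5)[OF q(2)] by simp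
          moreover have "\<pi> q \<notin> {u, e, ?v, \<pi> e}"
            using pairingD(3)[OF \<pi> \<open>q \<in> S\<close>] q(2) v(3) f(3) by auto
          ultimately show ?thesis by blast
        qed
        have uv: "u \<in> ?K \<longleftrightarrow> ?v \<in> ?K"
        proof (rule ccontr)
          assume "\<not> ?thesis"
          then consider "u \<in> ?K" "e \<in> ?K" "?v \<notin> ?K" "\<pi> e \<notin> ?K"
            | "?v \<in> ?K" "\<pi> e \<in> ?K" "u \<notin> ?K" "e \<notin> ?K" using ue vf by blast
          then show False
          proof cases
            case 1
            have "q \<in> S \<and> \<pi> q \<in> N w' - {u, e}" if "q \<in> ?K - {u, e}" for q
            proof -
              have "q \<notin> {u, e, ?v, \<pi> e}" using that 1 by blast
              then show ?thesis using old that by blast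
            qed
            then have "completes a S \<pi> u e" unfolding completes_def using w' 1 by blast
            then show False using ncu by simp
          next
            case 2
            have "q \<in> S \<and> \<pi> q \<in> N w' - {?v, \<pi> e}" if "q \<in> ?K - {?v, \<pi> e}" for q
            proof -
              have "q \<notin> {u, e, ?v, \<pi> e}" using that 2 by blast
              then show ?thesis using old that by blast
            qed
            then have "completes a S \<pi> ?v (\<pi> e)" unfolding completes_def using w' 2 by blast
            then show False using ncv by simp
          qed
        qed
        have "q \<in> S \<and> \<pi> q \<in> N w'" if "q \<in> ?K" for q
        proof (cases "q \<in> {u, e, ?v, \<pi> e}")
          case True
          then show ?thesis using that ue vf uv K[OF that] v(3) f(3) by auto
        next
          case False
          then show ?thesis using old that by blast
        qed
        then show ?thesis using w' by (simp add: full_def)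
      qed
      moreover have "\<not> full a S ?\<rho> w"
      proof
        assume "full a S ?\<rho> w"
        then have "?\<rho> u \<in> N w" using uw unfolding full_def by blast
        then show False using nw sw(1) by simp
      qed
      ultimately show "{w. full a S ?\<rho> w} \<subset> {w. full a S \<pi> w}" using full by blast
    qed
    ultimately show False using least[of ?\<rho>] by simp
  qed
  then show ?thesis using \<pi> \<pi>T by blast
qed

text \<open>Since \<open>w\<close> is not full, at most two pairs of \<open>S\<close> lie in
  \<open>N w\<close>. Such a pair has six common neighbours, two of them in \<open>N b\<close>; one
  of the other four is \<open>w\<close>, so each pair accounts for at most three vertices.\<close>

lemma card_sharing_pair_le:
  assumes ab: "a \<in> V" "b \<in> N a" and S: "S \<subseteq> N a - {b}"
    and \<pi>: "pairing S \<pi>" "\<And>w. \<not> full a S \<pi> w"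
    and w: "w \<in> V - (N a \<union> N b)"
  shows "card {w' \<in> V - (N a \<union> N b). w' \<noteq> w \<and> (\<exists>q\<in>S. {q, \<pi> q} \<subseteq> N w \<inter> N w')} \<le> 6"
proof -
  let ?W = "V - (N a \<union> N b)"
  have b: "b \<in> V" "a \<in> N b" using ab N_in_V N_sym by blast+
  have wa: "w \<in> V" "w \<noteq> a" "w \<notin> N a" using w b by auto
  define K where "K = {q \<in> S \<inter> N w. \<pi> q \<in> N w}"
  define D where "D = (\<lambda>X. {w' \<in> ?W. w' \<noteq> w \<and> X \<subseteq> N w'})"
  have K: "pairing K \<pi>" using \<pi>(1) by (auto simp: pairing_def K_def)
  have fin: "finite (N w \<inter> N a)" using finite_N ab(1) by simp
  have "K \<subset> N w \<inter> N a"
    using \<pi>(2)[of w] wa S unfolding full_def K_def by blast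
  then have "card K < card (N w \<inter> N a)" using fin by (rule psubset_card_mono[rotated])
  also have "\<dots> = 6" using card_common wa ab N_sym_iff by auto
  finally have K5: "card K \<le> 2 * 2 + 1" by simp
  have finK: "finite K" using \<open>K \<subset> N w \<inter> N a\<close> fin finite_subset by blast
  have D3: "card (D {q, \<pi> q}) \<le> 3" if q: "q \<in> K" for q
  proof -
    let ?r = "\<pi> q"
    have qr: "q \<in> N a" "?r \<in> N a" "?r \<noteq> q" "q \<noteq> b" "?r \<noteq> b"
      using q S pairingD[OF K q] by (auto simp: K_def)
    then have V: "q \<in> V" "?r \<in> V" using N_in_V ab by blast+
    have na: "?r \<notin> N q" "b \<notin> N q" "b \<notin> N ?r" using N_no_triangle[OF ab(1)] qr ab(2) by blast+
    have "card (N q \<inter> N ?r) = 6" using card_common V qr na by metis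
    moreover have "card (N q \<inter> N ?r \<inter> N b) = 2"
      using common_neighbours_of_three V b(1) qr na by metis
    ultimately have "card (N q \<inter> N ?r - N q \<inter> N ?r \<inter> N b) = 4"
      using finite_N V by (subst card_Diff_subset) auto
    moreover have "insert w (D {q, ?r}) \<subseteq> N q \<inter> N ?r - N q \<inter> N ?r \<inter> N b"
      using N_sym_iff V w q by (auto simp: D_def K_def)
    ultimately have "card (insert w (D {q, ?r})) \<le> 4"
      using card_mono[of "N q \<inter> N ?r - N q \<inter> N ?r \<inter> N b"] finite_N[OF V(1)]
      by (metis finite_Diff finite_Int)
    moreover have "finite (D {q, ?r})" "w \<notin> D {q, ?r}" using finite_V by (auto simp: D_def)
    ultimately show ?thesis by simp
  qed
  have "{w' \<in> ?W. w' \<noteq> w \<and> (\<exists>q\<in>S. {q, \<pi> q} \<subseteq> N w \<inter> N w')} \<subseteq> (\<Union>q\<in>K. D {q, \<pi> q})"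
    by (auto simp: D_def K_def)
  then have "card {w' \<in> ?W. w' \<noteq> w \<and> (\<exists>q\<in>S. {q, \<pi> q} \<subseteq> N w \<inter> N w')}
      \<le> card (\<Union>q\<in>K. D {q, \<pi> q})"
    by (rule card_mono[rotated]) (use finK finite_V in \<open>simp add: D_def\<close>)
  also have "\<dots> \<le> 2 * 3" by (rule card_Union_pairs_le[where C = D, OF finK K K5 D3])
  finally show ?thesis by simp
qed

section \<open>The 56 vertices off an edge, and the choice of the crossing pairs\<close>

lemma card_neighbours_off_edge:
  assumes ab: "a \<in> V" "b \<in> N a" and u: "u \<in> V - (N a \<union> N b)"
  shows "card (N u \<inter> (V - (N a \<union> N b))) = 10"
proof -
  have b: "b \<in> V" "a \<in> N b" using ab N_in_V N_sym by blast+
  have uV: "u \<in> V" "u \<noteq> a" "u \<noteq> b" "a \<notin> N u" "b \<notin> N u" using u ab b N_sym_iff by auto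
  have "card (N u \<inter> N a \<union> N u \<inter> N b) = 12"
    using triangle_free[OF ab] card_common[OF uV(1) ab(1) uV(2,4)] card_common[OF uV(1) b(1) uV(3,5)]
    by (subst card_Un_disjoint) (auto simp: finite_N uV)
  moreover have "N u \<inter> (V - (N a \<union> N b)) = N u - (N u \<inter> N a \<union> N u \<inter> N b)"
    using N_sub[OF uV(1)] by blast
  ultimately show ?thesis
    using card_N[OF uV(1)] finite_N[OF uV(1)] by (simp add: card_Diff_subset)
qed

text \<open>Of the six common neighbours of \<open>u\<close> and \<open>v\<close>, two lie in
  \<open>N a\<close> and two in \<open>N b\<close> by the result on three nonadjacent vertices;
  these neighbourhoods are disjoint.\<close>

lemma card_common_off_edge:
  assumes ab: "a \<in> V" "b \<in> N a" and u: "u \<in> V - (N a \<union> N b)" and v: "v \<in> V - (N a \<union> N b)"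
    and uv: "u \<noteq> v" "v \<notin> N u"
  shows "card (N u \<inter> N v \<inter> (V - (N a \<union> N b))) = 2"
proof -
  have b: "b \<in> V" "a \<in> N b" using ab N_in_V N_sym by blast+
  have uV: "u \<in> V" "u \<noteq> a" "u \<noteq> b" "a \<notin> N u" "b \<notin> N u" using u ab b N_sym_iff by auto
  have vV: "v \<in> V" "v \<noteq> a" "v \<noteq> b" "a \<notin> N v" "b \<notin> N v" using v ab b N_sym_iff by auto
  have "card (N u \<inter> N v \<inter> N a) = 2" "card (N u \<inter> N v \<inter> N b) = 2"
    using common_neighbours_of_three uV vV uv ab(1) b(1) by auto
  then have "card (N u \<inter> N v \<inter> N a \<union> N u \<inter> N v \<inter> N b) = 4"
    using triangle_free[OF ab] by (subst card_Un_disjoint) (auto simp: finite_N uV)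
  moreover have "N u \<inter> N v \<inter> (V - (N a \<union> N b)) =
      N u \<inter> N v - (N u \<inter> N v \<inter> N a \<union> N u \<inter> N v \<inter> N b)"
    using N_sub[OF uV(1)] by blast
  moreover have "card (N u \<inter> N v) = 6" using card_common uV vV uv by simp
  ultimately show ?thesis
    using finite_N[OF uV(1)] by (simp only:) (subst card_Diff_subset, auto)
qed

text \<open>The pairs \<open>{a, l}\<close> and \<open>{b, x}\<close> would span a 4-cycle if
  \<open>x\<close> and \<open>l\<close> were adjacent. But \<open>x\<close> has only six neighbours
  in \<open>N b\<close>, fewer than the 21 candidates for \<open>l\<close>.\<close>

lemma nonadjacent_pair_across_edge:
  assumes ab: "a \<in> V" "b \<in> N a"
  obtains x l where "x \<in> N a - {b}" "l \<in> N b - {a}" "l \<notin> N x"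
proof -
  have b: "b \<in> V" "a \<in> N b" using ab N_in_V N_sym by blast+
  have "card (N a - {b}) = 21" using card_N[OF ab(1)] ab(2) finite_N[OF ab(1)] by simp
  then have "N a - {b} \<noteq> {}" by force
  then obtain x where x: "x \<in> N a - {b}" by blast
  then have xV: "x \<in> V" using N_in_V ab by blast
  have "b \<notin> N x" using N_no_triangle[OF ab(1)] ab(2) x by blast
  then have "card (N x \<inter> N b) = 6" using card_common xV b(1) x by auto
  moreover have "card (N b - {a}) = 21" using card_N[OF b(1)] b(2) finite_N[OF b(1)] by simp
  moreover have "card (N b - {a}) \<le> card (N x \<inter> N b)" if "N b - {a} \<subseteq> N x"
    by (rule card_mono) (use that finite_N xV in auto)
  ultimately obtain l where "l \<in> N b - {a}" "l \<notin> N x" by fastforce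
  with x that show ?thesis by blast
qed

text \<open>To be applied from both ends of the edge, exchanging \<open>a\<close> with
  \<open>b\<close> and \<open>x\<close> with \<open>l\<close>. One of the six common neighbours of
  \<open>l\<close> and \<open>a\<close> is \<open>b\<close>, which is left out of the set; this
  gives the bound 5 needed to avoid pairs inside \<open>N l\<close>.\<close>

lemma pairing_on_neighbourhood:
  assumes ab: "a \<in> V" "b \<in> N a" and x: "x \<in> N a - {b}" and l: "l \<in> N b - {a}"
  obtains \<pi> where "pairing (N a - {b, x}) \<pi>"
    "\<And>q. q \<in> N a - {b, x} \<Longrightarrow> \<not> {q, \<pi> q} \<subseteq> N l"
    "\<And>w. \<not> full a (N a - {b, x}) \<pi> w"
proof -
  have b: "b \<in> V" "a \<in> N b" using ab N_in_V N_sym by blast+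
  have lV: "l \<in> V" using N_in_V b l by blast
  have "a \<notin> N l" using N_no_triangle[OF b(1)] b(2) l by blast
  then have "card (N l \<inter> N a) = 6" using card_common lV ab(1) l by auto
  moreover have "b \<in> N l \<inter> N a" using N_sym b l ab by blast
  ultimately have "card (N l \<inter> N a - {b}) = 5" using finite_N lV by simp
  moreover have "card ((N a - {b, x}) \<inter> N l) \<le> card (N l \<inter> N a - {b})"
    by (rule card_mono) (use finite_N lV in auto)
  ultimately have T: "card ((N a - {b, x}) \<inter> N l) \<le> 5" by simp
  have "card (N a - {b, x}) = 20"
    using card_N[OF ab(1)] ab(2) x by (auto simp: card_Diff_subset)
  from pairing_without_full[OF ab(1) Diff_subset this T] obtain \<pi>
    where "pairing (N a - {b, x}) \<pi>" "\<forall>q\<in>N a - {b, x}. \<not> (q \<in> N l \<and> \<pi> q \<in> N l)"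
      "\<forall>w. \<not> full a (N a - {b, x}) \<pi> w" by blast
  then show ?thesis using that[of \<pi>] by blast
qed

section \<open>Gluing the pairings\<close>

theorem pairing_without_cross_cycles:
  "\<exists>\<sigma>. pairing V \<sigma> \<and> (\<forall>v\<in>V. \<sigma> v \<notin> N v) \<and> (\<forall>u\<in>V. \<forall>z\<in>V. \<not> {z, \<sigma> z} \<subseteq> N u \<inter> N (\<sigma> u))"
proof -
  have "V \<noteq> {}" using card_V by auto
  then obtain a where a: "a \<in> V" by blast
  have "N a \<noteq> {}" using card_N[OF a] by auto
  then obtain b where ab: "b \<in> N a" by blast
  have b: "b \<in> V" and ba: "a \<in> N b" using a ab N_in_V N_sym by blast+
  obtain x l where x: "x \<in> N a - {b}" and l: "l \<in> N b - {a}" and xl: "l \<notin> N x"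
    using nonadjacent_pair_across_edge[OF a ab] .
  have xV: "x \<in> V" and lV: "l \<in> V" using x l a b N_in_V by blast+
  have lx: "x \<notin> N l" using xl N_sym_iff xV lV by blast
  define S1 where "S1 = N a - {b, x}"
  define S2 where "S2 = N b - {a, l}"
  define W where "W = V - (N a \<union> N b)"
  obtain \<pi>1 where \<pi>1: "pairing S1 \<pi>1" and \<pi>1l: "\<And>q. q \<in> S1 \<Longrightarrow> \<not> {q, \<pi>1 q} \<subseteq> N l"
    and full1: "\<And>w. \<not> full a S1 \<pi>1 w"
    using pairing_on_neighbourhood[OF a ab x l] unfolding S1_def by blast
  obtain \<pi>2 where \<pi>2: "pairing S2 \<pi>2" and \<pi>2x: "\<And>q. q \<in> S2 \<Longrightarrow> \<not> {q, \<pi>2 q} \<subseteq> N x"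
    and full2: "\<And>w. \<not> full b S2 \<pi>2 w"
    using pairing_on_neighbourhood[OF b ba l x] unfolding S2_def by blast
  have disj: "N a \<inter> N b = {}" using triangle_free a ab by blast
  have cW: "card W = 56"
  proof -
    have "card (N a \<union> N b) = 44"
      using disj finite_N card_N a b by (simp add: card_Un_disjoint)
    then show ?thesis
      unfolding W_def using card_V N_sub[OF a] N_sub[OF b] finite_N a b by (simp add: card_Diff_subset)
  qed
  have finW: "finite W" using finite_V by (simp add: W_def)
  define R1 where "R1 = (\<lambda>u e. \<exists>q\<in>S1. {q, \<pi>1 q} \<subseteq> N u \<inter> N e)"
  define R2 where "R2 = (\<lambda>u e. \<exists>q\<in>S2. {q, \<pi>2 q} \<subseteq> N u \<inter> N e)"
  \<comment> \<open>Forbidden partners in \<open>W\<close>: 10 neighbours, and at most 6 vertices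
    sharing a pair of either coclique, which gives the bound 22.\<close>
  define R where "R = (\<lambda>u e. e \<in> N u \<or> R1 u e \<or> R2 u e)"
  have degR: "card {e \<in> W. e \<noteq> u \<and> R u e} \<le> 22" if u: "u \<in> W" for u
  proof -
    have "{e \<in> W. e \<noteq> u \<and> R u e} \<subseteq>
        (N u \<inter> W) \<union> ({e \<in> W. e \<noteq> u \<and> R1 u e} \<union> {e \<in> W. e \<noteq> u \<and> R2 u e})"
      by (auto simp: R_def)
    then have "card {e \<in> W. e \<noteq> u \<and> R u e} \<le>
        card ((N u \<inter> W) \<union> ({e \<in> W. e \<noteq> u \<and> R1 u e} \<union> {e \<in> W. e \<noteq> u \<and> R2 u e}))"
      by (rule card_mono[rotated]) (use finW in simp)
    also have "\<dots> \<le> card (N u \<inter> W) + (card {e \<in> W. e \<noteq> u \<and> R1 u e} + card {e \<in> W. e \<noteq> u \<and> R2 u e})"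
      by (meson add_left_mono card_Un_le le_trans)
    finally have "card {e \<in> W. e \<noteq> u \<and> R u e} \<le>
        card (N u \<inter> W) + (card {e \<in> W. e \<noteq> u \<and> R1 u e} + card {e \<in> W. e \<noteq> u \<and> R2 u e})" .
    moreover have "card (N u \<inter> W) = 10"
      using card_neighbours_off_edge[OF a ab] u by (simp add: W_def)
    moreover have "card {e \<in> W. e \<noteq> u \<and> R1 u e} \<le> 6"
      using card_sharing_pair_le[OF a ab _ \<pi>1 full1] u unfolding W_def R1_def S1_def by blast
    moreover have "card {e \<in> W. e \<noteq> u \<and> R2 u e} \<le> 6"
      using card_sharing_pair_le[OF b ba _ \<pi>2 full2] u unfolding W_def R2_def S2_def
      by (simp add: Un_commute subset_iff)
    ultimately show ?thesis by linarith
  qed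
  have "\<exists>\<pi>. pairing W \<pi> \<and> (\<forall>u\<in>W. \<not> R u (\<pi> u)) \<and>
      (\<forall>u\<in>W. \<forall>z\<in>W. \<not> {z, \<pi> z} \<subseteq> N u \<inter> N (\<pi> u))"
  proof (rule pairing_without_4cycle[OF finW cW _ _ _ _ degR])
    show "x \<in> N y" if "x \<in> W" "y \<in> W" "y \<in> N x" for x y
      using that N_sym by (auto simp: W_def)
    show "x \<notin> N x" if "x \<in> W" for x using that N_irrefl by (auto simp: W_def)
    show "R y x" if "x \<in> W" "y \<in> W" "R x y" for x y
      using that N_sym unfolding R_def R1_def R2_def W_def by blast
    show "R x y" if "y \<in> N x" for x y using that by (simp add: R_def)
    show "card (N u \<inter> W) \<le> 10" if "u \<in> W" for u
      using card_neighbours_off_edge[OF a ab] that by (simp add: W_def)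
    show "card (N u \<inter> N v \<inter> W) \<le> 2" if "u \<in> W" "v \<in> W" "u \<noteq> v" "v \<notin> N u" for u v
      using card_common_off_edge[OF a ab] that by (simp add: W_def)
  qed
  then obtain \<pi>3 where \<pi>3: "pairing W \<pi>3" and \<pi>3R: "\<And>u. u \<in> W \<Longrightarrow> \<not> R u (\<pi>3 u)"
    and \<pi>3c: "\<And>u z. u \<in> W \<Longrightarrow> z \<in> W \<Longrightarrow> \<not> {z, \<pi>3 z} \<subseteq> N u \<inter> N (\<pi>3 u)"
    by blast
  define \<sigma> where "\<sigma> = (\<lambda>v. if v = a then l else if v = l then a else if v = b then x
    else if v = x then b else if v \<in> S1 then \<pi>1 v else if v \<in> S2 then \<pi>2 v else \<pi>3 v)"
  have ne: "a \<noteq> b" "a \<noteq> x" "a \<noteq> l" "b \<noteq> x" "b \<noteq> l" "x \<noteq> l"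
    using N_irrefl a b ab ba x l disj by blast+
  have sep: "S1 \<inter> {a, b, x, l} = {}" "S2 \<inter> {a, b, x, l} = {}" "W \<inter> {a, b, x, l} = {}"
      "S1 \<inter> S2 = {}" "W \<inter> S1 = {}" "W \<inter> S2 = {}"
    using N_irrefl a b ab ba x l disj unfolding S1_def S2_def W_def by blast+
  have \<sigma>_simps: "\<sigma> a = l" "\<sigma> l = a" "\<sigma> b = x" "\<sigma> x = b"
    using ne by (auto simp: \<sigma>_def)
  have \<sigma>1: "\<sigma> v = \<pi>1 v" if "v \<in> S1" for v using that sep by (auto simp: \<sigma>_def)
  have \<sigma>2: "\<sigma> v = \<pi>2 v" if "v \<in> S2" for v using that sep by (auto simp: \<sigma>_def)
  have \<sigma>3: "\<sigma> v = \<pi>3 v" if "v \<in> W" for v using that sep by (auto simp: \<sigma>_def)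
  have V_eq: "V = {a, l} \<union> {b, x} \<union> S1 \<union> S2 \<union> W"
    using a b xV lV N_sub[OF a] N_sub[OF b] unfolding S1_def S2_def W_def by blast
  have \<sigma>S: "\<sigma> v \<in> S1 \<and> \<sigma> v \<noteq> v \<and> \<sigma> (\<sigma> v) = v" if "v \<in> S1" for v
    using that \<sigma>1 pairingD[OF \<pi>1] by simp
  have \<sigma>S2: "\<sigma> v \<in> S2 \<and> \<sigma> v \<noteq> v \<and> \<sigma> (\<sigma> v) = v" if "v \<in> S2" for v
    using that \<sigma>2 pairingD[OF \<pi>2] by simp
  have \<sigma>W: "\<sigma> v \<in> W \<and> \<sigma> v \<noteq> v \<and> \<sigma> (\<sigma> v) = v" if "v \<in> W" for v
    using that \<sigma>3 pairingD[OF \<pi>3] by simp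
  have \<sigma>: "pairing V \<sigma>"
    unfolding pairing_def
  proof
    fix v assume "v \<in> V"
    then consider "v \<in> {a, l, b, x}" | "v \<in> S1" | "v \<in> S2" | "v \<in> W" using V_eq by blast
    then show "\<sigma> v \<in> V \<and> \<sigma> v \<noteq> v \<and> \<sigma> (\<sigma> v) = v"
    proof cases
      case 1 then show ?thesis using \<sigma>_simps ne a b xV lV by auto
    next
      case 2 then show ?thesis using \<sigma>S V_eq by blast
    next
      case 3 then show ?thesis using \<sigma>S2 V_eq by blast
    next
      case 4 then show ?thesis using \<sigma>W V_eq by blast
    qed
  qed
  have S1N: "S1 \<subseteq> N a" and S2N: "S2 \<subseteq> N b" by (auto simp: S1_def S2_def)
  have nonadj: "\<sigma> v \<notin> N v" if "v \<in> V" for v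
  proof -
    have "l \<notin> N a" "a \<notin> N l" "x \<notin> N b" "b \<notin> N x"
      using disj x l N_no_triangle[OF b ba] N_no_triangle[OF a ab] N_no_triangle[OF b _ ba]
        N_no_triangle[OF a _ ab] by blast+
    then have 1: "\<sigma> v \<notin> N v" if "v \<in> {a, l, b, x}" using that \<sigma>_simps by auto
    have 2: "\<sigma> v \<notin> N v" if "v \<in> S1" using that \<sigma>S S1N N_no_triangle[OF a] by blast
    have 3: "\<sigma> v \<notin> N v" if "v \<in> S2" using that \<sigma>S2 S2N N_no_triangle[OF b] by blast
    have 4: "\<sigma> v \<notin> N v" if "v \<in> W" using that \<sigma>3 \<pi>3R by (auto simp: R_def)
    show ?thesis using 1 2 3 4 that V_eq by blast
  qed
  \<comment> \<open>\<open>conf u z\<close> says that the pairs of \<open>u\<close> and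
    \<open>z\<close> are completely joined. It is unaffected by exchanging the pairs or passing to a
    partner, so one representative of each combination of parts suffices.\<close>
  define conf where "conf = (\<lambda>u z. {z, \<sigma> z} \<subseteq> N u \<inter> N (\<sigma> u))"
  have conf_sym: "conf z u" if "conf u z" "u \<in> V" for u z
    using that N_sym pairingD(1)[OF \<sigma>] unfolding conf_def by blast
  have conf_sw: "conf u z \<longleftrightarrow> conf (\<sigma> u) z" if "u \<in> V" for u z
    using pairingD(3)[OF \<sigma> that] unfolding conf_def by auto
  have WN: "W \<inter> N a = {}" "W \<inter> N b = {}" by (auto simp: W_def)
  \<comment> \<open>A pair inside \<open>N a\<close> is \<open>{b, x}\<close> or a pair of
    \<open>S1\<close>. The former is not inside \<open>N l\<close> because \<open>x\<close> and
    \<open>l\<close> are nonadjacent, the latter by the choice of \<open>\<pi>1\<close>.\<close>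
  have conf_a: "\<not> conf a z" if "z \<in> V" for z
  proof
    assume c: "conf a z"
    then have z: "z \<in> N a" "\<sigma> z \<in> N a" "z \<in> N l" "\<sigma> z \<in> N l"
      using \<sigma>_simps by (auto simp: conf_def)
    then have "z \<notin> {a, l, b, x}" using lx \<sigma>_simps N_irrefl[OF a] by auto
    moreover have "z \<notin> S1" using \<pi>1l \<sigma>1 z by force
    ultimately show False using z that V_eq S2N WN disj by blast
  qed
  have conf_b: "\<not> conf b z" if "z \<in> V" for z
  proof
    assume c: "conf b z"
    then have z: "z \<in> N b" "\<sigma> z \<in> N b" "z \<in> N x" "\<sigma> z \<in> N x"
      using \<sigma>_simps by (auto simp: conf_def)
    then have "z \<notin> {a, l, b, x}" using xl \<sigma>_simps N_irrefl[OF b] by auto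
    moreover have "z \<notin> S2" using \<pi>2x \<sigma>2 z by force
    ultimately show False using z that V_eq S1N WN disj by blast
  qed
  have conf_4: "\<not> conf u z" if "u \<in> {a, l, b, x}" "z \<in> V" for u z
    using conf_a[OF that(2)] conf_b[OF that(2)] conf_sw[OF a] conf_sw[OF b] that(1) \<sigma>_simps by auto
  have conf_11: "\<not> conf u z" if "u \<in> S1" "z \<in> S1" for u z
    using that S1N N_no_triangle[OF a] unfolding conf_def by blast
  have conf_22: "\<not> conf u z" if "u \<in> S2" "z \<in> S2" for u z
    using that S2N N_no_triangle[OF b] unfolding conf_def by blast
  have conf_12: "\<not> conf u z" if u: "u \<in> S1" and z: "z \<in> S2" for u z
  proof
    assume "conf u z"
    have us: "u \<in> N a" "\<sigma> u \<in> N a" "\<sigma> u \<noteq> u" "u \<noteq> b" "\<sigma> u \<noteq> b"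
      using \<sigma>S[OF u] u by (auto simp: S1_def)
    have V: "u \<in> V" "\<sigma> u \<in> V" using us N_in_V[OF a] by blast+
    \<comment> \<open>The vertices \<open>u\<close>, \<open>\<sigma> u\<close> and \<open>b\<close>
      would have three common neighbours, namely \<open>a\<close> and the pair of
      \<open>z\<close>.\<close>
    have "{a, z, \<sigma> z} \<subseteq> N u \<inter> N (\<sigma> u) \<inter> N b"
      using \<open>conf u z\<close> us N_sym[OF a] ba \<sigma>S2[OF z] z S2N unfolding conf_def by blast
    then have "card {a, z, \<sigma> z} \<le> card (N u \<inter> N (\<sigma> u) \<inter> N b)"
      by (rule card_mono[rotated]) (use finite_N b in simp)
    also have "\<dots> \<le> 2" using common_neighbours_le_2 V b us by metis
    finally show False using \<sigma>S2[OF z] z by (auto simp: S2_def card_insert_if split: if_splits)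
  qed
  have conf_1W: "\<not> conf u z" if u: "u \<in> S1" and z: "z \<in> W" for u z
  proof
    assume "conf u z"
    then have "conf z u" using conf_sym u V_eq by blast
    then have "R z (\<pi>3 z)"
      using u z \<sigma>1[OF u] \<sigma>3[OF z] unfolding conf_def R_def R1_def by auto
    then show False using \<pi>3R z by blast
  qed
  have conf_2W: "\<not> conf u z" if u: "u \<in> S2" and z: "z \<in> W" for u z
  proof
    assume "conf u z"
    then have "conf z u" using conf_sym u V_eq by blast
    then have "R z (\<pi>3 z)"
      using u z \<sigma>2[OF u] \<sigma>3[OF z] unfolding conf_def R_def R2_def by auto
    then show False using \<pi>3R z by blast
  qed
  have conf_WW: "\<not> conf u z" if "u \<in> W" "z \<in> W" for u z
    using \<pi>3c[OF that] \<sigma>3 that by (simp add: conf_def)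
  have "\<not> conf u z" if "u \<in> V" "z \<in> V" for u z
  proof
    assume c: "conf u z"
    then have c': "conf z u" using conf_sym that by blast
    have "u \<in> S1 \<union> S2 \<union> W" using conf_4 c that V_eq by blast
    moreover have "z \<in> S1 \<union> S2 \<union> W" using conf_4 c' that V_eq by blast
    ultimately show False
      using c c' conf_11 conf_12 conf_22 conf_1W conf_2W conf_WW by blast
  qed
  then show ?thesis using \<sigma> nonadj unfolding conf_def by blast
qed

end

section \<open>The Higman--Sims graph of a Steiner system S(3,6,22)\<close>

text \<open>Connectedness is strong connectedness of the symmetrised graph, so a single arc
  suffices.\<close>

lemma connected_induced_pair:
  assumes "(x, y) \<in> parcs G"
  shows "connected (with_proj G \<restriction> {x, y})"
proof -
  let ?H = "mk_symmetric (with_proj G \<restriction> {x, y})"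
  have arcs: "(x, y) \<in> parcs ?H" "(y, x) \<in> parcs ?H"
    unfolding parcs_mk_symmetric by (rule UN_I[of "(x, y)"]; use assms in simp)+
  have "u \<rightarrow>\<^sup>*\<^bsub>with_proj ?H\<^esub> v" if "u \<in> {x, y}" "v \<in> {x, y}" for u v
    using that arcs unfolding reachable_def
    by (auto intro!: rtrancl_on_refl rtrancl_on_into_rtrancl_on[OF rtrancl_on_refl])
  then show ?thesis by (simp add: connected_def strongly_connected_def)
qed

lemma hs_adj_sym: "hs_adj u v \<longleftrightarrow> hs_adj v u"
  by (cases u; cases v) auto

text \<open>Double counting of the incidences between \<open>F\<close> and \<open>X\<close>.\<close>

lemma sum_card_Int:
  assumes "finite F" "finite X" "\<And>p. p \<in> X \<Longrightarrow> card {B \<in> F. p \<in> B} = m"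
  shows "(\<Sum>B\<in>F. card (B \<inter> X)) = card X * m"
proof -
  have "(\<Sum>B\<in>F. card (B \<inter> X)) = (\<Sum>B\<in>F. \<Sum>p\<in>X. if p \<in> B then 1 else 0)"
    using assms(2) by (simp add: sum.If_cases Int_def conj_commute)
  also have "\<dots> = (\<Sum>p\<in>X. \<Sum>B\<in>F. if p \<in> B then 1 else 0)" by (rule sum.swap)
  also have "\<dots> = (\<Sum>p\<in>X. m)"
    using assms(1,3) by (intro sum.cong refl) (simp add: sum.If_cases Int_def)
  finally show ?thesis by simp
qed

text \<open>A member of \<open>F\<close> that meets \<open>X\<close> uses exactly two of the
  \<open>card X * m\<close> incidences. The equation is arranged to avoid division and subtraction
  of naturals.\<close>

lemma card_disjoint_of_meeting_in_2:
  assumes "finite F" "finite X" "\<And>p. p \<in> X \<Longrightarrow> card {B \<in> F. p \<in> B} = m"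
    and "\<And>B. B \<in> F \<Longrightarrow> B \<inter> X \<noteq> {} \<Longrightarrow> card (B \<inter> X) = 2"
  shows "card {B \<in> F. B \<inter> X = {}} * 2 + card X * m = card F * 2"
proof -
  have "card X * m = (\<Sum>B\<in>F. card (B \<inter> X))" using sum_card_Int[OF assms(1-3)] by simp
  also have "\<dots> = (\<Sum>B\<in>F. if B \<inter> X \<noteq> {} then 2 else 0)"
    by (intro sum.cong refl) (use assms(4) in auto)
  also have "\<dots> = card {B \<in> F. B \<inter> X \<noteq> {}} * 2"
    using assms(1) by (simp add: sum.If_cases Int_def)
  finally have 1: "card {B \<in> F. B \<inter> X \<noteq> {}} * 2 = card X * m" by simp
  have "card F = card ({B \<in> F. B \<inter> X \<noteq> {}} \<union> {B \<in> F. B \<inter> X = {}})"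
    by (rule arg_cong[where f = card]) auto
  also have "\<dots> = card {B \<in> F. B \<inter> X \<noteq> {}} + card {B \<in> F. B \<inter> X = {}}"
    by (rule card_Un_disjoint) (use assms(1) in auto)
  finally show ?thesis
    using 1 by simp
qed

lemma sum_eq_bound_imp_eq:
  fixes f :: "'a \<Rightarrow> nat"
  assumes "finite A" "\<And>x. x \<in> A \<Longrightarrow> f x \<le> k" "sum f A = card A * k" "x \<in> A"
  shows "f x = k"
proof (rule ccontr)
  assume "f x \<noteq> k"
  then have "sum f A < (\<Sum>x\<in>A. k)"
    using assms by (intro sum_strict_mono_ex1) (auto simp: order_less_le)
  then show False using assms(3) by simp
qed

locale steiner_3_6_22 =
  fixes \<B> :: "nat set set"
  assumes steiner: "steiner_system 3 6 {1..22} \<B>" and card_\<B>: "card \<B> = 77"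
begin

section \<open>Block counts in S(3,6,22)\<close>

abbreviation "\<P> \<equiv> {1..22 :: nat}"

lemma finite_\<B>: "finite \<B>"
  using card_\<B> by (simp add: card_ge_0_finite)

lemma block: "B \<in> \<B> \<Longrightarrow> B \<subseteq> \<P>" "B \<in> \<B> \<Longrightarrow> card B = 6"
  using steiner by (auto simp: steiner_system_def)

lemma finite_block: "B \<in> \<B> \<Longrightarrow> finite B"
  using block(1) finite_subset by blast

lemma card_blocks_through_3:
  assumes "T \<subseteq> \<P>" "card T = 3"
  shows "card {B \<in> \<B>. T \<subseteq> B} = 1"
proof -
  have "\<exists>!B. B \<in> \<B> \<and> T \<subseteq> B" using steiner assms by (auto simp: steiner_system_def)
  then obtain B where "{B \<in> \<B>. T \<subseteq> B} = {B}" by blast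
  then show ?thesis by simp
qed

lemma card_block_Int_le_2:
  assumes "B \<in> \<B>" "C \<in> \<B>" "B \<noteq> C"
  shows "card (B \<inter> C) \<le> 2"
proof (rule ccontr)
  assume "\<not> ?thesis"
  then have "3 \<le> card (B \<inter> C)" by simp
  then obtain T where T: "T \<subseteq> B \<inter> C" "card T = 3"
    using obtain_subset_with_card_n by metis
  then have "card {B, C} \<le> card {B \<in> \<B>. T \<subseteq> B}"
    using assms T finite_\<B> by (intro card_mono) auto
  moreover have "T \<subseteq> \<P>" using T assms block(1) by blast
  ultimately show False using card_blocks_through_3 T assms(3) by simp
qed

text \<open>Each of the other 20 points lies with \<open>p\<close> and \<open>q\<close> in one
  block, and each block through both contains four of them.\<close>

lemma card_blocks_through_2:
  assumes "p \<in> \<P>" "q \<in> \<P>" "p \<noteq> q"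
  shows "card {B \<in> \<B>. p \<in> B \<and> q \<in> B} = 5"
proof -
  let ?F = "{B \<in> \<B>. p \<in> B \<and> q \<in> B}" and ?X = "\<P> - {p, q}"
  have "(\<Sum>B\<in>?F. card (B \<inter> ?X)) = card ?X * 1"
  proof (rule sum_card_Int)
    fix s assume s: "s \<in> ?X"
    then have "card {B \<in> \<B>. {p, q, s} \<subseteq> B} = 1"
      using assms by (intro card_blocks_through_3) auto
    moreover have "{B \<in> ?F. s \<in> B} = {B \<in> \<B>. {p, q, s} \<subseteq> B}" by auto
    ultimately show "card {B \<in> ?F. s \<in> B} = 1" by simp
  qed (use finite_\<B> in auto)
  also have "(\<Sum>B\<in>?F. card (B \<inter> ?X)) = (\<Sum>B\<in>?F. 4)"
  proof (rule sum.cong)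
    fix B assume B: "B \<in> ?F"
    then have "B \<inter> ?X = B - {p, q}" using block(1) by blast
    then show "card (B \<inter> ?X) = 4"
      using B block(2)[of B] finite_block[of B] assms(3) by (simp add: card_Diff_subset)
  qed simp
  also have "card ?X = 20" using assms by (simp add: card_Diff_subset)
  finally show ?thesis by simp
qed

lemma card_blocks_through:
  assumes "p \<in> \<P>"
  shows "card {B \<in> \<B>. p \<in> B} = 21"
proof -
  let ?F = "{B \<in> \<B>. p \<in> B}" and ?X = "\<P> - {p}"
  have "(\<Sum>B\<in>?F. card (B \<inter> ?X)) = card ?X * 5"
  proof (rule sum_card_Int)
    fix s assume s: "s \<in> ?X"
    have "{B \<in> ?F. s \<in> B} = {B \<in> \<B>. p \<in> B \<and> s \<in> B}" by auto
    then show "card {B \<in> ?F. s \<in> B} = 5" using card_blocks_through_2 s assms by simp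
  qed (use finite_\<B> in auto)
  also have "(\<Sum>B\<in>?F. card (B \<inter> ?X)) = (\<Sum>B\<in>?F. 5)"
  proof (rule sum.cong)
    fix B assume B: "B \<in> ?F"
    then have "B \<inter> ?X = B - {p}" using block(1) by blast
    then show "card (B \<inter> ?X) = 5" using B block(2)[of B] finite_block[of B] by simp
  qed simp
  also have "card ?X = 21" using assms by simp
  finally show ?thesis by simp
qed

text \<open>Fix a common point \<open>p\<close>. The 20 other blocks through \<open>p\<close> meet
  \<open>B - {p}\<close> in at most one point each, and the 5 * 4 incidences there leave no
  slack.\<close>

lemma card_block_Int:
  assumes B: "B \<in> \<B>" and C: "C \<in> \<B>" "C \<noteq> B" and meet: "C \<inter> B \<noteq> {}"
  shows "card (C \<inter> B) = 2"
proof -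
  obtain p where p: "p \<in> B" "p \<in> C" using meet by auto
  then have pP: "p \<in> \<P>" using B block by blast
  let ?F = "{C \<in> \<B>. p \<in> C} - {B}" and ?X = "B - {p}"
  have cF: "card ?F = 20" using card_blocks_through[OF pP] B p(1) finite_\<B> by simp
  have "(\<Sum>C\<in>?F. card (C \<inter> ?X)) = card ?X * 4"
  proof (rule sum_card_Int)
    fix q assume q: "q \<in> ?X"
    have "{C \<in> ?F. q \<in> C} = {C \<in> \<B>. p \<in> C \<and> q \<in> C} - {B}" by auto
    moreover have "card {C \<in> \<B>. p \<in> C \<and> q \<in> C} = 5"
      using card_blocks_through_2 pP q B block by blast
    ultimately show "card {C \<in> ?F. q \<in> C} = 4" using B p q finite_\<B> by simp
  qed (use finite_\<B> finite_block B in auto)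
  also have "\<dots> = card ?F * 1" using cF p(1) block(2)[OF B] finite_block[OF B] by simp
  finally have sum: "(\<Sum>C\<in>?F. card (C \<inter> ?X)) = card ?F * 1" .
  have C_Int: "card (C \<inter> B) = Suc (card (C \<inter> ?X))" if "C \<in> ?F" for C
  proof -
    have "C \<inter> B = insert p (C \<inter> ?X)" using that p(1) by auto
    then show ?thesis using finite_block[OF B] by simp
  qed
  have "card (C \<inter> ?X) = 1"
  proof (rule sum_eq_bound_imp_eq[OF _ _ sum])
    show "card (C \<inter> ?X) \<le> 1" if "C \<in> ?F" for C
      using C_Int[OF that] card_block_Int_le_2[of C B] that B by auto
  qed (use finite_\<B> C p in auto)
  then show ?thesis using C_Int[of C] C p by simp
qed

text \<open>Each of the six points of \<open>B\<close> lies on 20 of the 76 other blocks, so 120 / 2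
  = 60 of these meet \<open>B\<close>.\<close>

lemma card_disjoint_blocks:
  assumes B: "B \<in> \<B>"
  shows "card {C \<in> \<B>. C \<inter> B = {}} = 16"
proof -
  let ?F = "\<B> - {B}"
  have "card {C \<in> ?F. C \<inter> B = {}} * 2 + card B * 20 = card ?F * 2"
  proof (rule card_disjoint_of_meeting_in_2)
    fix p assume p: "p \<in> B"
    have "{C \<in> ?F. p \<in> C} = {C \<in> \<B>. p \<in> C} - {B}" by auto
    moreover have "p \<in> \<P>" using p B block(1) by blast
    ultimately show "card {C \<in> ?F. p \<in> C} = 20"
      using card_blocks_through p B finite_\<B> by simp
  qed (use finite_\<B> finite_block B card_block_Int in auto)
  moreover have "{C \<in> ?F. C \<inter> B = {}} = {C \<in> \<B>. C \<inter> B = {}}" using block(2)[OF B] by auto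
  ultimately show ?thesis using B card_\<B> finite_\<B> block(2) by simp
qed

text \<open>Of the 21 blocks through \<open>p\<close>, 6 * 5 / 2 = 15 meet \<open>B\<close>.\<close>

lemma card_disjoint_blocks_through:
  assumes B: "B \<in> \<B>" and p: "p \<in> \<P>" "p \<notin> B"
  shows "card {C \<in> \<B>. C \<inter> B = {} \<and> p \<in> C} = 6"
proof -
  let ?F = "{C \<in> \<B>. p \<in> C}"
  have "card {C \<in> ?F. C \<inter> B = {}} * 2 + card B * 5 = card ?F * 2"
  proof (rule card_disjoint_of_meeting_in_2)
    fix q assume q: "q \<in> B"
    have "{C \<in> ?F. q \<in> C} = {C \<in> \<B>. p \<in> C \<and> q \<in> C}" by auto
    moreover have "q \<in> \<P>" "p \<noteq> q" using q p B block(1) by blast+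
    ultimately show "card {C \<in> ?F. q \<in> C} = 5"
      using card_blocks_through_2 p by simp
  next
    fix C assume "C \<in> ?F" "C \<inter> B \<noteq> {}"
    then show "card (C \<inter> B) = 2" using card_block_Int[OF B, of C] p(2) by auto
  qed (use finite_\<B> finite_block B in auto)
  moreover have "{C \<in> ?F. C \<inter> B = {}} = {C \<in> \<B>. C \<inter> B = {} \<and> p \<in> C}" by auto
  ultimately show ?thesis using block(2)[OF B] card_blocks_through[OF p(1)] by simp
qed

text \<open>The 15 blocks other than \<open>C\<close> that avoid \<open>B\<close> have 6 * 5 = 30
  incidences with \<open>C\<close> and at most two each, so every one of them meets \<open>C\<close>
  in exactly two points.\<close>

lemma no_three_disjoint_blocks:
  assumes B: "B \<in> \<B>" and C: "C \<in> \<B>" "C \<inter> B = {}" and D: "D \<in> \<B>" "D \<inter> B = {}"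
  shows "D \<inter> C \<noteq> {}"
proof (cases "D = C")
  case True
  then show ?thesis using block(2)[OF C(1)] by auto
next
  case False
  let ?F = "{E \<in> \<B>. E \<inter> B = {}} - {C}"
  have cF: "card ?F = 15" using card_disjoint_blocks[OF B] C finite_\<B> by simp
  have "(\<Sum>E\<in>?F. card (E \<inter> C)) = card C * 5"
  proof (rule sum_card_Int)
    fix p assume p: "p \<in> C"
    have "{E \<in> ?F. p \<in> E} = {E \<in> \<B>. E \<inter> B = {} \<and> p \<in> E} - {C}" by auto
    moreover have "card {E \<in> \<B>. E \<inter> B = {} \<and> p \<in> E} = 6"
      using card_disjoint_blocks_through[OF B] p C block(1) by blast
    ultimately show "card {E \<in> ?F. p \<in> E} = 5" using C p finite_\<B> by simp
  qed (use finite_\<B> finite_block C in auto)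
  also have "\<dots> = card ?F * 2" using cF block(2)[OF C(1)] by simp
  finally have sum: "(\<Sum>E\<in>?F. card (E \<inter> C)) = card ?F * 2" .
  have "card (D \<inter> C) = 2"
    by (rule sum_eq_bound_imp_eq[OF _ _ sum]) (use finite_\<B> card_block_Int_le_2 C D False in auto)
  then show ?thesis by auto
qed

text \<open>A block avoiding \<open>B\<close> can meet \<open>C\<close> only in
  \<open>C - B\<close>. Each of these four points lies on six of the 16 blocks avoiding
  \<open>B\<close>, so 24 / 2 = 12 of them meet \<open>C\<close>.\<close>

lemma card_blocks_disjoint_from_2:
  assumes B: "B \<in> \<B>" and C: "C \<in> \<B>" "C \<noteq> B" "C \<inter> B \<noteq> {}"
  shows "card {D \<in> \<B>. D \<inter> B = {} \<and> D \<inter> C = {}} = 4"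
proof -
  let ?F = "{D \<in> \<B>. D \<inter> B = {}}" and ?X = "C - B"
  have "C - B = C - C \<inter> B" by auto
  then have cX: "card ?X = 4"
    using card_block_Int[OF B C] block(2)[OF C(1)] finite_block[OF C(1)]
    by (simp add: card_Diff_subset)
  have "card {D \<in> ?F. D \<inter> ?X = {}} * 2 + card ?X * 6 = card ?F * 2"
  proof (rule card_disjoint_of_meeting_in_2)
    fix p assume p: "p \<in> ?X"
    have "{D \<in> ?F. p \<in> D} = {D \<in> \<B>. D \<inter> B = {} \<and> p \<in> D}" by auto
    moreover have "p \<in> \<P>" using p C(1) block(1) by blast
    ultimately show "card {D \<in> ?F. p \<in> D} = 6"
      using card_disjoint_blocks_through[OF B] p by simp
  next
    fix D assume D: "D \<in> ?F" "D \<inter> ?X \<noteq> {}"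
    then have "D \<inter> ?X = D \<inter> C" by auto
    moreover have "D \<noteq> C" using D C by auto
    ultimately show "card (D \<inter> ?X) = 2" using card_block_Int[OF C(1), of D] D by auto
  qed (use finite_\<B> finite_block C in auto)
  moreover have "{D \<in> ?F. D \<inter> ?X = {}} = {D \<in> \<B>. D \<inter> B = {} \<and> D \<inter> C = {}}" by auto
  ultimately show ?thesis using card_disjoint_blocks[OF B] cX by simp
qed

section \<open>Strong regularity of the Higman-Sims graph\<close>

definition HV :: "hs_vertex set" where
  "HV = Block ` \<B> \<union> Point ` \<P> \<union> {Infinity}"

definition HN :: "hs_vertex \<Rightarrow> hs_vertex set" where
  "HN u = {v \<in> HV. hs_adj u v}"

lemma HV_cases:
  assumes "u \<in> HV"
  obtains B where "u = Block B" "B \<in> \<B>" | p where "u = Point p" "p \<in> \<P>" | "u = Infinity"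
  using assms by (auto simp: HV_def)

lemma HN_Infinity: "HN Infinity = Point ` \<P>"
  by (auto simp: HN_def HV_def)

lemma HN_Point: "HN (Point p) = insert Infinity (Block ` {B \<in> \<B>. p \<in> B})"
  by (auto simp: HN_def HV_def)

lemma HN_Block:
  assumes "B \<in> \<B>"
  shows "HN (Block B) = Point ` B \<union> Block ` {C \<in> \<B>. C \<inter> B = {}}"
proof (rule set_eqI)
  fix v
  show "v \<in> HN (Block B) \<longleftrightarrow> v \<in> Point ` B \<union> Block ` {C \<in> \<B>. C \<inter> B = {}}"
    using block(1)[OF assms] by (cases v) (auto simp: HN_def HV_def Int_commute image_iff)
qed

lemma card_Block_image: "card (Block ` F) = card F"
  by (rule card_image) (simp add: inj_on_def)

lemma card_Point_image: "card (Point ` F) = card F"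
  by (rule card_image) (simp add: inj_on_def)

lemma card_HV: "card HV = 100"
proof -
  have "card (Block ` \<B> \<union> Point ` \<P>) = 99"
    using finite_\<B> card_\<B> by (subst card_Un_disjoint) (auto simp: card_Block_image card_Point_image)
  moreover have "HV = insert Infinity (Block ` \<B> \<union> Point ` \<P>)" by (auto simp: HV_def)
  ultimately show ?thesis using finite_\<B> by (simp add: image_iff)
qed

lemma card_Point_Block_Un:
  "finite X \<Longrightarrow> finite F \<Longrightarrow> card (Point ` X \<union> Block ` F) = card X + card F"
  by (subst card_Un_disjoint) (auto simp: card_Block_image card_Point_image)

lemma card_HN:
  assumes "u \<in> HV"
  shows "card (HN u) = 22"
  using assms
proof (cases rule: HV_cases)
  case (1 B)
  then show ?thesis
    using block(2) finite_block finite_\<B> card_disjoint_blocks by (simp add: HN_Block card_Point_Block_Un)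
next
  case (2 p)
  then show ?thesis
    using finite_\<B> card_blocks_through by (simp add: HN_Point image_iff card_Block_image)
next
  case 3
  then show ?thesis by (simp add: HN_Infinity card_Point_image)
qed

lemma HN_triangle_free:
  assumes u: "u \<in> HV" and v: "v \<in> HN u"
  shows "HN u \<inter> HN v = {}"
proof (rule ccontr)
  assume "HN u \<inter> HN v \<noteq> {}"
  then obtain w where w: "w \<in> HV" "hs_adj u w" "hs_adj v w" by (auto simp: HN_def)
  have v: "v \<in> HV" "hs_adj u v" using v by (auto simp: HN_def)
  \<comment> \<open>Only a triangle of three blocks needs the design. Points are pairwise
    nonadjacent, \<open>Infinity\<close> sees points only, and no point lies in two disjoint
    blocks.\<close>
  show False
  proof (rule HV_cases[OF u]; rule HV_cases[OF v(1)]; rule HV_cases[OF w(1)])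
    fix B C D assume "u = Block B" "B \<in> \<B>" "v = Block C" "C \<in> \<B>" "w = Block D" "D \<in> \<B>"
    then show False using w v no_three_disjoint_blocks[of B C D] by (simp add: Int_commute)
  qed (use w v in auto)
qed

lemma card_HN_common_Points:
  assumes "p \<in> \<P>" "q \<in> \<P>" "p \<noteq> q"
  shows "card (HN (Point p) \<inter> HN (Point q)) = 6"
proof -
  have "HN (Point p) \<inter> HN (Point q) = insert Infinity (Block ` {B \<in> \<B>. p \<in> B \<and> q \<in> B})"
    by (auto simp: HN_Point)
  then show ?thesis
    using card_blocks_through_2[OF assms] finite_\<B> by (simp add: image_iff card_Block_image)
qed

lemma card_HN_common_Point_Block:
  assumes "p \<in> \<P>" "B \<in> \<B>" "p \<notin> B"
  shows "card (HN (Point p) \<inter> HN (Block B)) = 6"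
proof -
  have "HN (Point p) \<inter> HN (Block B) = Block ` {C \<in> \<B>. C \<inter> B = {} \<and> p \<in> C}"
    using assms by (auto simp: HN_Point HN_Block)
  then show ?thesis using card_disjoint_blocks_through assms by (simp add: card_Block_image)
qed

lemma card_HN_common_Blocks:
  assumes "B \<in> \<B>" "C \<in> \<B>" "C \<noteq> B" "C \<inter> B \<noteq> {}"
  shows "card (HN (Block B) \<inter> HN (Block C)) = 6"
proof -
  have "HN (Block B) \<inter> HN (Block C) =
      Point ` (C \<inter> B) \<union> Block ` {D \<in> \<B>. D \<inter> B = {} \<and> D \<inter> C = {}}"
    using assms by (auto simp: HN_Block)
  then show ?thesis
    using card_block_Int[OF assms] card_blocks_disjoint_from_2[OF assms] finite_\<B> finite_block assms
    by (simp add: card_Point_Block_Un)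
qed

lemma card_HN_common_Infinity_Block:
  assumes "B \<in> \<B>"
  shows "card (HN Infinity \<inter> HN (Block B)) = 6"
proof -
  have "HN Infinity \<inter> HN (Block B) = Point ` B"
    using assms block(1)[OF assms] by (auto simp: HN_Infinity HN_Block)
  then show ?thesis using block(2) assms by (simp add: card_Point_image)
qed

text \<open>The value 6 arises as 1 + 5 for two points and as 2 + 4 for two meeting blocks; for a
  point off a block all six are blocks, and for \<open>Infinity\<close> and a block they are the
  points of the block.\<close>

lemma card_HN_common:
  assumes u: "u \<in> HV" and v: "v \<in> HV" and uv: "u \<noteq> v" "v \<notin> HN u"
  shows "card (HN u \<inter> HN v) = 6"
proof -
  have na: "\<not> hs_adj u v" using uv v by (simp add: HN_def)
  show ?thesis
  proof (rule HV_cases[OF u]; rule HV_cases[OF v])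
    fix B C assume "u = Block B" "B \<in> \<B>" "v = Block C" "C \<in> \<B>"
    then show ?thesis using na uv card_HN_common_Blocks[of B C] by (auto simp: Int_commute)
  next
    fix p B assume "u = Point p" "p \<in> \<P>" "v = Block B" "B \<in> \<B>"
    then show ?thesis using na card_HN_common_Point_Block by simp
  next
    fix B p assume "u = Block B" "B \<in> \<B>" "v = Point p" "p \<in> \<P>"
    then show ?thesis using na card_HN_common_Point_Block by (simp add: Int_commute)
  next
    fix p q assume "u = Point p" "p \<in> \<P>" "v = Point q" "q \<in> \<P>"
    then show ?thesis using uv card_HN_common_Points by simp
  next
    fix B assume "u = Infinity" "v = Block B" "B \<in> \<B>"
    then show ?thesis using card_HN_common_Infinity_Block by simp
  next
    fix B assume "u = Block B" "B \<in> \<B>" "v = Infinity"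
    then show ?thesis using card_HN_common_Infinity_Block by (simp add: Int_commute)
  qed (use na uv in auto)
qed

sublocale srg_100_22_0_6 HV HN
proof
  show "HN x \<subseteq> HV" for x by (auto simp: HN_def)
  show "x \<in> HN y" if "x \<in> HV" "y \<in> HN x" for x y
    using that hs_adj_sym by (auto simp: HN_def)
qed (fact card_HV card_HN HN_triangle_free card_HN_common)+

section \<open>The complement and its model\<close>

lemma complement_simps:
  "pverts (graph_complement (higman_sims \<B>)) = HV"
  "(u, v) \<in> parcs (graph_complement (higman_sims \<B>)) \<longleftrightarrow> u \<in> HV \<and> v \<in> HV \<and> u \<noteq> v \<and> v \<notin> HN u"
  by (auto simp: graph_complement_def higman_sims_def Let_def HV_def HN_def)

text \<open>Independent sets of the complement are cliques of a triangle-free graph; an edge at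
  \<open>Infinity\<close> attains the value 2.\<close>

lemma independence_number_complement:
  "independence_number (graph_complement (higman_sims \<B>)) = 2"
proof -
  let ?G = "graph_complement (higman_sims \<B>)"
  have sub: "S \<subseteq> HV" if "independent_set ?G S" for S
    using that by (simp add: independent_set_def complement_simps)
  have adj: "v \<in> HN u" if "independent_set ?G S" "u \<in> S" "v \<in> S" "u \<noteq> v" for S u v
    using that sub[OF that(1)] by (auto simp: independent_set_def complement_simps)
  have "card S \<le> 2" if S: "independent_set ?G S" for S
  proof (rule ccontr)
    assume "\<not> card S \<le> 2"
    then have "3 \<le> card S" by simp
    then obtain T where T: "T \<subseteq> S" "card T = 3" using obtain_subset_with_card_n by metis
    then obtain x y z where "T = {x, y, z}" "x \<noteq> y" "x \<noteq> z" "y \<noteq> z"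
      by (auto simp: card_3_iff)
    then show False
      using adj[OF S] T(1) sub[OF S] N_no_triangle[of x y z] by auto
  qed
  moreover have "2 \<in> card ` {S. independent_set ?G S}"
  proof -
    have 1: "Point 1 \<in> HN Infinity" by (simp add: HN_Infinity)
    moreover have V: "Infinity \<in> HV" "Point 1 \<in> HV" by (auto simp: HV_def)
    ultimately have "independent_set ?G {Infinity, Point 1}"
      using N_sym[OF V(1) 1] by (simp add: independent_set_def complement_simps)
    moreover have "card {Infinity, Point 1} = 2" by simp
    ultimately show ?thesis by (metis image_eqI mem_Collect_eq)
  qed
  moreover have "finite {S. independent_set ?G S}"
    by (rule finite_subset[of _ "Pow HV"]) (use sub finite_V in auto)
  ultimately show ?thesis
    unfolding independence_number_def by (intro Max_eqI) auto
qed

lemma complement_model: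
  "\<exists>\<M>. complete_model (graph_complement (higman_sims \<B>)) 50 \<M> \<and> (\<forall>X\<in>\<M>. card X = 2)"
proof -
  let ?G = "graph_complement (higman_sims \<B>)"
  obtain \<sigma> where \<sigma>: "pairing HV \<sigma>" and na: "\<And>v. v \<in> HV \<Longrightarrow> \<sigma> v \<notin> HN v"
    and cyc: "\<And>u z. u \<in> HV \<Longrightarrow> z \<in> HV \<Longrightarrow> \<not> {z, \<sigma> z} \<subseteq> HN u \<inter> HN (\<sigma> u)"
    using pairing_without_cross_cycles by blast
  let ?M = "(\<lambda>v. {v, \<sigma> v}) ` HV"
  have "card X = 2" if "X \<in> ?M" for X
    using that pairingD(2)[OF \<sigma>] by (auto simp: card_2_iff)
  moreover have "complete_model ?G 50 ?M"
    unfolding complete_model_def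
  proof (intro conjI ballI impI)
    show "finite ?M" using finite_V by simp
    show "card ?M = 50" using card_pairs[OF finite_V \<sigma>] card_V by simp
    fix X assume X: "X \<in> ?M"
    then obtain u where u: "u \<in> HV" "X = {u, \<sigma> u}" by blast
    note su = pairingD[OF \<sigma> u(1)]
    show "X \<subseteq> pverts ?G" using u su by (simp add: complement_simps)
    show "connected (with_proj ?G \<restriction> X)"
      unfolding u(2) by (rule connected_induced_pair) (use u su na in \<open>auto simp: complement_simps\<close>)
    fix Y assume Y: "Y \<in> ?M" "X \<noteq> Y"
    then obtain z where z: "z \<in> HV" "Y = {z, \<sigma> z}" by blast
    note sz = pairingD[OF \<sigma> z(1)]
    show disj: "X \<inter> Y = {}"
    proof (rule ccontr)
      assume "X \<inter> Y \<noteq> {}"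
      then obtain t where t: "t \<in> X" "t \<in> Y" by blast
      have "X = {t, \<sigma> t}" using t(1) u(2) su(3) by auto
      moreover have "Y = {t, \<sigma> t}" using t(2) z(2) sz(3) by auto
      ultimately show False using Y(2) by simp
    qed
    \<comment> \<open>As the two pairs are not completely joined, some cross pair is nonadjacent and
      hence, the pairs being disjoint, an edge of the complement.\<close>
    have "\<exists>x\<in>X. \<exists>y\<in>Y. y \<notin> HN x" using cyc[OF u(1) z(1)] u z by auto
    then obtain x y where xy: "x \<in> X" "y \<in> Y" "y \<notin> HN x" by blast
    moreover have "x \<in> HV" "y \<in> HV" "x \<noteq> y" using xy u z su sz disj by auto
    ultimately show "\<exists>x\<in>X. \<exists>y\<in>Y. (x, y) \<in> parcs ?G" by (auto simp: complement_simps)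
  qed
  ultimately show ?thesis by blast
qed

end

theorem theorem3p18:
  fixes \<B> :: "nat set set" and G :: "hs_vertex pair_pre_digraph"
  assumes "steiner_system 3 6 {1..22} \<B>"
    and "card \<B> = 77"
    and "G = graph_complement (higman_sims \<B>)"
  shows "card (pverts G) = 100 \<and> independence_number G = 2 \<and>
    (\<exists>\<M>. complete_model G 50 \<M> \<and> (\<forall>X\<in>\<M>. card X = 2)) \<and>
    (\<exists>\<M>. complete_model G (nat \<lceil>real (card (pverts G)) / 2\<rceil>) \<M> \<and> (\<forall>X\<in>\<M>. card X \<le> 2))"
proof -
  interpret steiner_3_6_22 \<B> using assms(1,2) by unfold_locales
  obtain \<M> where \<M>: "complete_model G 50 \<M>" "\<forall>X\<in>\<M>. card X = 2"
    using complement_model assms(3) by blast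
  have c: "card (pverts G) = 100" using card_HV assms(3) by (simp add: complement_simps)
  then have "nat \<lceil>real (card (pverts G)) / 2\<rceil> = 50" by simp
  then show ?thesis
    using c \<M> independence_number_complement assms(3) by (metis order_refl)
qed

end
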